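(* Let $X$ be a Tychonoff space, and let $L(X)$ be the free locally convex space over $X$. Then $L(X)$ is an Ascoli space if and only if $X$ is a countable discrete space.
   Context: Locally convex spaces are real and Hausdorff. The free locally convex space $L(X)$ on a Tychonoff space $X$ is a locally convex space $L(X)$ together with a continuous map $i: X\to L(X)$ such that for every continuous map $f$ from $X$ to a locally convex space $E$ there is a unique continuous linear operator $\bar f: L(X)\to E$ with $f=\bar f\circ i$. It always exists and is unique up to isomorphism; $i$ is a topological embedding and $i(X)$ is a Hamel basis of $L(X)$. For a Tychonoff space $Y$, $C_k(Y)$ denotes the space $C(Y)$ of all continuous real-valued functions on $Y$ endowed with the compact-open topology. A Tychonoff space $Y$ is called an Ascoli space if every compact subset $\mathcal{K}$ of $C_k(Y)$ is equicontinuous, i.e. for every $y\in Y$ and every $\varepsilon>0$ there is a neighborhood $U$ of $y$ such that $|f(u)-f(y)|<\varepsilon$ for all $u\in U$ and all $f\in\mathcal{K}$. "Countable" includes finite. *)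

theory Defs
  imports "HOL-Analysis.Analysis" "HOL-Analysis.Finite_Function_Topology"
begin

definition tychonoff_space :: "'a topology \<Rightarrow> bool" where
  "tychonoff_space X \<longleftrightarrow> completely_regular_space X \<and> Hausdorff_space X"

definition countable_discrete_space :: "'a topology \<Rightarrow> bool" where
  "countable_discrete_space X \<longleftrightarrow>
     countable (topspace X) \<and> X = discrete_topology (topspace X)"


section \<open>Locally convex spaces and free locally convex spaces\<close>

text \<open>
  A locally convex space is a topology on a linear subspace \<open>topspace E\<close> of a type of class
  \<open>real_vector\<close>.  The type itself carries no topology; should it happen to have a class topology
  (as \<open>'a \<Rightarrow>\<^sub>0 real\<close> does), that topology plays no role here.
\<close>

definition locally_convex_space :: "'v::real_vector topology \<Rightarrow> bool" where
  "locally_convex_space E \<longleftrightarrow>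
     subspace (topspace E) \<and>
     continuous_map (prod_topology E E) E (\<lambda>(x, y). x + y) \<and>
     continuous_map (prod_topology euclideanreal E) E (\<lambda>(c, x). c *\<^sub>R x) \<and>
     neighbourhood_base_at 0 convex E \<and>
     Hausdorff_space E"

definition continuous_operator ::
    "'v::real_vector topology \<Rightarrow> 'w::real_vector topology \<Rightarrow> ('v \<Rightarrow> 'w) \<Rightarrow> bool" where
  "continuous_operator L E g \<longleftrightarrow>
     continuous_map L E g \<and>
     (\<forall>x\<in>topspace L. \<forall>y\<in>topspace L. g (x + y) = g x + g y) \<and>
     (\<forall>c. \<forall>x\<in>topspace L. g (c *\<^sub>R x) = c *\<^sub>R g x)"

text \<open>
  Every continuous map \<open>X \<rightarrow> E\<close> factors uniquely through \<open>i\<close> by a continuous operator \<open>L \<rightarrow> E\<close>.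
  Restricting to extensional functions makes uniqueness mean uniqueness on \<open>topspace L\<close>.
\<close>

definition extends_uniquely ::
    "'a topology \<Rightarrow> 'v::real_vector topology \<Rightarrow> ('a \<Rightarrow> 'v) \<Rightarrow> 'e::real_vector topology \<Rightarrow> bool" where
  "extends_uniquely X L i E \<longleftrightarrow>
     (\<forall>f. continuous_map X E f \<longrightarrow>
        (\<exists>!g. g \<in> extensional (topspace L) \<and> continuous_operator L E g \<and>
              (\<forall>x\<in>topspace X. g (i x) = f x)))"

text \<open>
  HOL cannot quantify over all types inside a formula, so the test spaces \<open>E\<close> in the universal
  property range over all locally convex spaces inside two types: \<open>'a \<Rightarrow>\<^sub>0 real\<close>, which contains
  a copy of the linear span of the image of any map defined on \<open>X\<close>, and the type of \<open>L\<close> itself.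
  This is no restriction: the lemma \<open>free_locally_convex_space_universal\<close> below derives the
  universal property for locally convex spaces inside an arbitrary type.
\<close>

definition free_locally_convex_space ::
    "'a topology \<Rightarrow> 'v::real_vector topology \<Rightarrow> ('a \<Rightarrow> 'v) \<Rightarrow> bool" where
  "free_locally_convex_space X L i \<longleftrightarrow>
     locally_convex_space L \<and>
     continuous_map X L i \<and>
     (\<forall>E :: ('a \<Rightarrow>\<^sub>0 real) topology. locally_convex_space E \<longrightarrow> extends_uniquely X L i E) \<and>
     (\<forall>E :: 'v topology. locally_convex_space E \<longrightarrow> extends_uniquely X L i E)"


section \<open>The space of continuous functions and Ascoli spaces\<close>

text \<open>
  As elements of the function space, continuous functions are normalised to be extensional on
  \<open>topspace Y\<close>.  The compact set \<open>K = {}\<close> contributes the whole function space to the subbase.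
\<close>

definition compact_open_topology :: "'a topology \<Rightarrow> ('a \<Rightarrow> real) topology" where
  "compact_open_topology Y =
     topology_generated_by
       {{f \<in> extensional (topspace Y). continuous_map Y euclideanreal f \<and> f ` K \<subseteq> U} |K U.
          compactin Y K \<and> open U}"

lemma topspace_compact_open_topology:
  "topspace (compact_open_topology Y) =
     {f \<in> extensional (topspace Y). continuous_map Y euclideanreal f}"
proof -
  have "{f \<in> extensional (topspace Y). continuous_map Y euclideanreal f}
      \<in> {{f \<in> extensional (topspace Y). continuous_map Y euclideanreal f \<and> f ` K \<subseteq> U} |K U.
          compactin Y K \<and> open U}"
    by (rule CollectI, rule exI[of _ "{}"], rule exI[of _ UNIV]) auto
  then show ?thesis
    unfolding compact_open_topology_def topology_generated_by_topspace by blast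
qed

definition equicontinuous_family :: "'a topology \<Rightarrow> ('a \<Rightarrow> real) set \<Rightarrow> bool" where
  "equicontinuous_family Y F \<longleftrightarrow>
     (\<forall>y\<in>topspace Y. \<forall>\<epsilon>>0. \<exists>U. openin Y U \<and> y \<in> U \<and> (\<forall>u\<in>U. \<forall>f\<in>F. \<bar>f u - f y\<bar> < \<epsilon>))"

definition ascoli_space :: "'a topology \<Rightarrow> bool" where
  "ascoli_space Y \<longleftrightarrow>
     tychonoff_space Y \<and>
     (\<forall>\<K>. compactin (compact_open_topology Y) \<K> \<longrightarrow> equicontinuous_family Y \<K>)"


section \<open>The universal property for arbitrary types\<close>

lemma locally_convex_space_subtopology:
  assumes E: "locally_convex_space E" and W: "subspace W" "W \<subseteq> topspace E"
  shows "locally_convex_space (subtopology E W)"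
proof -
  have ts: "topspace (subtopology E W) = W"
    using W by auto
  have "continuous_map (prod_topology (subtopology E W) (subtopology E W)) (subtopology E W)
      (\<lambda>(x, y). x + y)"
    unfolding prod_topology_subtopology
    using E W by (auto simp: locally_convex_space_def continuous_map_in_subtopology subtopology_subtopology
      intro!: continuous_map_from_subtopology subspace_add)
  moreover have "continuous_map (prod_topology euclideanreal (subtopology E W)) (subtopology E W)
      (\<lambda>(c, x). c *\<^sub>R x)"
    unfolding prod_topology_subtopology
    using E W by (auto simp: locally_convex_space_def continuous_map_in_subtopology
      intro!: continuous_map_from_subtopology subspace_scale)
  moreover have "neighbourhood_base_at 0 convex (subtopology E W)"
    unfolding neighbourhood_base_at_def
  proof (intro allI impI, elim conjE)
    fix U assume "openin (subtopology E W) U" "(0::'a) \<in> U"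
    then obtain T where T: "openin E T" "U = T \<inter> W" "0 \<in> T"
      by (auto simp: openin_subtopology)
    then obtain A C where "openin E A" "convex C" "0 \<in> A" "A \<subseteq> C" "C \<subseteq> T"
      using E unfolding locally_convex_space_def neighbourhood_base_at_def by meson
    moreover have "0 \<in> W" "convex W"
      using W by (auto simp: subspace_0 subspace_imp_convex)
    ultimately show "\<exists>A C. openin (subtopology E W) A \<and> convex C \<and> 0 \<in> A \<and> A \<subseteq> C \<and> C \<subseteq> U"
      unfolding T(2) by (intro exI[of _ "A \<inter> W"] exI[of _ "C \<inter> W"])
        (auto simp: openin_subtopology_Int convex_Int)
  qed
  ultimately show ?thesis
    using E W(1) unfolding locally_convex_space_def ts
    by (simp add: Hausdorff_space_subtopology)
qed

lemma locally_convex_space_homeomorphic: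
  assumes E: "locally_convex_space E" and hom: "homeomorphic_maps E F \<phi> \<psi>"
    and lin: "linear \<phi>" "linear \<psi>"
  shows "locally_convex_space F"
proof -
  have cont: "continuous_map E F \<phi>" "continuous_map F E \<psi>"
    and inv: "\<And>y. y \<in> topspace F \<Longrightarrow> \<phi> (\<psi> y) = y" "\<And>x. x \<in> topspace E \<Longrightarrow> \<psi> (\<phi> x) = x"
    using hom by (auto simp: homeomorphic_maps_def)
  have im: "topspace F = \<phi> ` topspace E"
    using hom homeomorphic_imp_surjective_map homeomorphic_maps_map by blast
  have sub: "subspace (topspace F)"
    unfolding im using E lin by (auto simp: locally_convex_space_def intro: linear_subspace_image)
  have "continuous_map (prod_topology F F) F (\<phi> \<circ> (\<lambda>(x, y). x + y) \<circ> (\<lambda>(x, y). (\<psi> x, \<psi> y)))"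
    using E cont unfolding locally_convex_space_def
    by (intro continuous_map_compose[where X' = "prod_topology E E"] continuous_map_compose[where X' = E])
      (auto simp: continuous_map_prod_top)
  then have add: "continuous_map (prod_topology F F) F (\<lambda>(x, y). x + y)"
    by (rule continuous_map_eq) (auto simp: linear_add[OF lin(1)] inv)
  have "continuous_map (prod_topology euclideanreal F) F
      (\<phi> \<circ> (\<lambda>(c, x). c *\<^sub>R x) \<circ> (\<lambda>(c, x). (id c, \<psi> x)))"
    using E cont unfolding locally_convex_space_def
    by (intro continuous_map_compose[where X' = "prod_topology euclideanreal E"]
          continuous_map_compose[where X' = E])
      (auto simp: continuous_map_prod_top simp del: id_apply)
  then have scale: "continuous_map (prod_topology euclideanreal F) F (\<lambda>(c, x). c *\<^sub>R x)"
    by (rule continuous_map_eq) (auto simp: linear_scale[OF lin(1)] inv)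
  have "neighbourhood_base_at 0 convex F"
    unfolding neighbourhood_base_at_def
  proof (intro allI impI, elim conjE)
    fix U assume U: "openin F U" "(0::'b) \<in> U"
    let ?T = "{x \<in> topspace E. \<phi> x \<in> U}"
    have "openin E ?T" using cont(1) U by (simp add: openin_continuous_map_preimage)
    moreover have "0 \<in> ?T"
      using E U lin by (auto simp: locally_convex_space_def subspace_0 linear_0)
    ultimately obtain A C where AC: "openin E A" "convex C" "0 \<in> A" "A \<subseteq> C" "C \<subseteq> ?T"
      using E unfolding locally_convex_space_def neighbourhood_base_at_def by meson
    have "openin F (\<phi> ` A)"
      using AC(1) hom homeomorphic_imp_open_map homeomorphic_maps_map open_map_def by blast
    moreover have "0 \<in> \<phi> ` A" using AC(3) linear_0[OF lin(1)] by force
    moreover have "convex (\<phi> ` C)" using AC(2) lin by (simp add: convex_linear_image)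
    ultimately show "\<exists>A C. openin F A \<and> convex C \<and> 0 \<in> A \<and> A \<subseteq> C \<and> C \<subseteq> U"
      using AC by blast
  qed
  moreover have "Hausdorff_space F"
    using E hom homeomorphic_Hausdorff_space homeomorphic_space_def
    unfolding locally_convex_space_def by blast
  ultimately show ?thesis
    using sub add scale by (simp add: locally_convex_space_def)
qed

lemma independent_single:
  "independent (range (\<lambda>x::'a. Poly_Mapping.single x (1::real)))"
  unfolding independent_explicit_finite_subsets
proof (intro allI impI ballI, rule ccontr)
  fix A u a
  assume A: "A \<subseteq> range (\<lambda>x::'a. Poly_Mapping.single x (1::real))" "finite A"
    "(\<Sum>v\<in>A. u v *\<^sub>R v) = 0" "a \<in> A" "u a \<noteq> 0"
  then obtain x where x: "a = Poly_Mapping.single x 1" by auto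
  have scale: "Poly_Mapping.lookup (c *\<^sub>R p) y = c * Poly_Mapping.lookup p y"
    for c :: real and p :: "'a \<Rightarrow>\<^sub>0 real" and y
  proof -
    have "finite {i. c *\<^sub>R Poly_Mapping.lookup p i \<noteq> 0}"
      by (rule finite_subset[OF _ finite_keys[of p]]) (auto simp: in_keys_iff)
    then show ?thesis by (simp add: scaleR_poly_mapping_def)
  qed
  have "0 = Poly_Mapping.lookup (\<Sum>v\<in>A. u v *\<^sub>R v) x" using A by simp
  also have "\<dots> = (\<Sum>v\<in>A. u v * Poly_Mapping.lookup v x)"
    by (simp add: lookup_sum scale)
  also have "\<dots> = (\<Sum>v\<in>A. if v = a then u a else 0)"
  proof (rule sum.cong)
    fix v assume "v \<in> A"
    then obtain y where "v = Poly_Mapping.single y 1" using A(1) by auto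
    then show "u v * Poly_Mapping.lookup v x = (if v = a then u a else 0)"
      by (cases "y = x") (auto simp: x lookup_single dest: arg_cong[where f = Poly_Mapping.keys])
  qed simp
  also have "\<dots> = u a" using A by simp
  finally show False using A by simp
qed

lemma linear_embedding_span_image:
  fixes f :: "'a \<Rightarrow> 'e::real_vector"
  obtains \<phi> :: "'e \<Rightarrow> 'a \<Rightarrow>\<^sub>0 real" where "linear \<phi>" "inj_on \<phi> (span (f ` S))"
proof -
  obtain B where B: "B \<subseteq> f ` S" "independent B" "f ` S \<subseteq> span B"
    using maximal_independent_subset by blast
  define k where "k b = (SOME x. f x = b)" for b
  have k: "f (k b) = b" if "b \<in> B" for b
    unfolding k_def by (rule someI_ex) (use B that in auto)
  obtain \<phi> where \<phi>: "linear \<phi>" "\<And>b. b \<in> B \<Longrightarrow> \<phi> b = Poly_Mapping.single (k b) (1::real)"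
    using linear_independent_extend[OF B(2), of "\<lambda>b. Poly_Mapping.single (k b) (1::real)"] by auto
  have "\<phi> ` B \<subseteq> range (\<lambda>x. Poly_Mapping.single x 1)"
    using \<phi>(2) by auto
  then have "independent (\<phi> ` B)"
    using independent_mono independent_single by blast
  moreover have "inj_on \<phi> B"
  proof (rule inj_onI)
    fix b c assume "b \<in> B" "c \<in> B" "\<phi> b = \<phi> c"
    then have "Poly_Mapping.lookup (Poly_Mapping.single (k b) (1::real)) (k b)
        = Poly_Mapping.lookup (Poly_Mapping.single (k c) 1) (k b)"
      using \<phi>(2) by simp
    then have "k b = k c" by (simp add: lookup_single when_def split: if_splits)
    then show "b = c" using k \<open>b \<in> B\<close> \<open>c \<in> B\<close> by metis
  qed
  ultimately have "inj_on \<phi> (span B)"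
    using \<phi>(1) linear_inj_on_span_independent_image by blast
  moreover have "span (f ` S) \<subseteq> span B"
    using B(3) by (metis span_mono span_span)
  ultimately show ?thesis using that \<phi>(1) inj_on_subset by blast
qed

lemma free_locally_convex_space_span:
  fixes L :: "'v::real_vector topology"
  assumes "free_locally_convex_space X L i"
  shows "topspace L = span (i ` topspace X)"
proof
  let ?S = "span (i ` topspace X)"
  have L: "locally_convex_space L" and i: "continuous_map X L i"
    and univ: "\<And>E :: 'v topology. locally_convex_space E \<Longrightarrow> extends_uniquely X L i E"
    using assms by (auto simp: free_locally_convex_space_def)
  have sub: "subspace (topspace L)" using L by (simp add: locally_convex_space_def)
  show S: "?S \<subseteq> topspace L"
  proof (rule span_minimal[OF _ sub])
    show "i ` topspace X \<subseteq> topspace L" using i by (auto simp: continuous_map_def)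
  qed
  then have "extends_uniquely X L i (subtopology L ?S)"
    using L univ by (simp add: locally_convex_space_subtopology)
  moreover have "continuous_map X (subtopology L ?S) i"
    using i by (auto simp: continuous_map_in_subtopology intro: span_base)
  ultimately have "\<exists>!g. g \<in> extensional (topspace L) \<and> continuous_operator L (subtopology L ?S) g \<and>
      (\<forall>x\<in>topspace X. g (i x) = i x)"
    unfolding extends_uniquely_def by (elim allE impE)
  then obtain g where g: "g \<in> extensional (topspace L)"
    "continuous_operator L (subtopology L ?S) g" "\<forall>x\<in>topspace X. g (i x) = i x"
    by (elim ex1E conjE)
  have gL: "continuous_operator L L g"
    using g(2) by (auto simp: continuous_operator_def continuous_map_in_subtopology)
  let ?id = "restrict id (topspace L)"
  have "continuous_map L L ?id"
    by (rule continuous_map_eq[OF continuous_map_id]) auto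
  then have idL: "continuous_operator L L ?id"
    using sub by (auto simp: continuous_operator_def subspace_add subspace_scale)
  have "\<forall>x\<in>topspace X. i x \<in> topspace L"
    using i by (auto simp: continuous_map_def)
  then have "\<forall>x\<in>topspace X. ?id (i x) = i x" by simp
  then have id: "?id \<in> extensional (topspace L) \<and> continuous_operator L L ?id \<and>
      (\<forall>x\<in>topspace X. ?id (i x) = i x)"
    using idL by (intro conjI restrict_extensional)
  have "\<exists>!g. g \<in> extensional (topspace L) \<and> continuous_operator L L g \<and>
      (\<forall>x\<in>topspace X. g (i x) = i x)"
    using univ[OF L] i unfolding extends_uniquely_def by (elim allE impE)
  then have "\<exists>\<^sub>\<le>\<^sub>1g. g \<in> extensional (topspace L) \<and> continuous_operator L L g \<and>
      (\<forall>x\<in>topspace X. g (i x) = i x)"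
    by (simp only: ex1_iff_ex_Uniq)
  then have "g = ?id"
    by (rule Uniq_D) (intro conjI g(1) gL g(3), rule id)
  moreover have "g ` topspace L \<subseteq> ?S"
    using g(2) by (auto simp: continuous_operator_def continuous_map_in_subtopology)
  ultimately show "topspace L \<subseteq> ?S" by (auto simp: image_subset_iff)
qed

lemma continuous_operator_eq_on_span:
  assumes "continuous_operator L E g" "continuous_operator L E h" "subspace (topspace L)"
    "A \<subseteq> topspace L" "\<And>x. x \<in> A \<Longrightarrow> g x = h x" "x \<in> span A"
  shows "g x = h x"
proof -
  have "subspace {x \<in> topspace L. g x = h x}"
  proof (rule subspaceI)
    have "g 0 = 0" "h 0 = 0"
      using assms(1-3) subspace_0 scaleR_zero_left unfolding continuous_operator_def by metis+
    then show "0 \<in> {x \<in> topspace L. g x = h x}" using assms(3) by (simp add: subspace_0)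
  qed (use assms(1-3) in \<open>auto simp: continuous_operator_def subspace_add subspace_scale\<close>)
  then have "span A \<subseteq> {x \<in> topspace L. g x = h x}"
    using assms(4,5) by (intro span_minimal) auto
  then show ?thesis using assms(6) by auto
qed

lemma free_locally_convex_space_universal:
  fixes E :: "'e::real_vector topology"
  assumes free: "free_locally_convex_space X L i" and E: "locally_convex_space E"
  shows "extends_uniquely X L i E"
  unfolding extends_uniquely_def
proof (intro allI impI)
  fix f :: "'a \<Rightarrow> 'e" assume f: "continuous_map X E f"
  have L: "locally_convex_space L" and i: "continuous_map X L i"
    and univ: "\<And>E :: ('a \<Rightarrow>\<^sub>0 real) topology. locally_convex_space E \<Longrightarrow> extends_uniquely X L i E"
    using free by (auto simp: free_locally_convex_space_def)
  have sub: "subspace (topspace L)" "subspace (topspace E)"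
    using L E by (simp_all add: locally_convex_space_def)
  let ?W = "span (f ` topspace X)"
  have W: "?W \<subseteq> topspace E"
  proof (rule span_minimal[OF _ sub(2)])
    show "f ` topspace X \<subseteq> topspace E" using f by (auto simp: continuous_map_def)
  qed
  obtain \<phi> :: "'e \<Rightarrow> 'a \<Rightarrow>\<^sub>0 real" where \<phi>: "linear \<phi>" "inj_on \<phi> ?W"
    using linear_embedding_span_image by blast
  obtain \<psi> where \<psi>: "linear \<psi>" "\<And>v. v \<in> ?W \<Longrightarrow> \<psi> (\<phi> v) = v"
    using linear_exists_left_inverse_on[OF \<phi>(1) _ \<phi>(2)] by auto
  define EW where "EW = subtopology E ?W"
  define F where "F = pullback_topology (\<phi> ` ?W) \<psi> EW"
  have tW: "topspace EW = ?W" using W by (auto simp: EW_def)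
  have tF: "topspace F = \<phi> ` ?W"
    unfolding F_def topspace_pullback_topology tW using \<psi>(2) by auto
  have "continuous_map EW F \<phi>"
    unfolding continuous_map_def
  proof (intro conjI allI impI)
    show "\<phi> \<in> topspace EW \<rightarrow> topspace F" by (auto simp: tW tF)
    fix U assume "openin F U"
    then obtain V where V: "openin EW V" "U = \<psi> -` V \<inter> \<phi> ` ?W"
      by (auto simp: F_def openin_pullback_topology)
    have "{x \<in> topspace EW. \<phi> x \<in> U} = V"
      using openin_subset[OF V(1)] \<phi>(2) unfolding V(2) tW by (auto simp: \<psi>(2) dest: inj_onD)
    then show "openin EW {x \<in> topspace EW. \<phi> x \<in> U}" using V by simp
  qed
  moreover have "continuous_map F EW \<psi>"
    unfolding F_def using continuous_map_pullback[OF continuous_map_id, where f = \<psi> and A = "\<phi> ` ?W"] by simp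
  ultimately have hom: "homeomorphic_maps EW F \<phi> \<psi>"
    using \<psi>(2) by (auto simp: homeomorphic_maps_def tW tF)
  have "locally_convex_space EW"
    unfolding EW_def using E W by (simp add: locally_convex_space_subtopology)
  then have "locally_convex_space F"
    using hom \<phi>(1) \<psi>(1) locally_convex_space_homeomorphic by blast
  moreover have "continuous_map X EW f"
    unfolding EW_def using f by (auto simp: continuous_map_in_subtopology intro: span_base)
  then have "continuous_map X F (\<phi> \<circ> f)"
    using hom continuous_map_compose unfolding homeomorphic_maps_def by blast
  ultimately obtain g where g: "continuous_operator L F g"
    "\<And>x. x \<in> topspace X \<Longrightarrow> g (i x) = \<phi> (f x)"
    using univ[of F] unfolding extends_uniquely_def comp_def by blast
  have "continuous_map L EW (\<psi> \<circ> g)"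
    using g(1) hom continuous_map_compose
    unfolding homeomorphic_maps_def continuous_operator_def by blast
  then have "continuous_map L E (\<psi> \<circ> g)"
    by (simp add: EW_def continuous_map_in_subtopology)
  define h where "h = restrict (\<psi> \<circ> g) (topspace L)"
  have "continuous_map L E h"
    using \<open>continuous_map L E (\<psi> \<circ> g)\<close> by (rule continuous_map_eq) (simp add: h_def)
  then have h: "continuous_operator L E h"
    using g(1) sub(1) \<psi>(1)
    by (auto simp: continuous_operator_def h_def subspace_add subspace_scale linear_add linear_scale)
  have iL: "i x \<in> topspace L" if "x \<in> topspace X" for x
    using i that by (auto simp: continuous_map_def)
  have hi: "h (i x) = f x" if "x \<in> topspace X" for x
    using that iL by (simp add: h_def g(2) \<psi>(2) span_base)
  show "\<exists>!g. g \<in> extensional (topspace L) \<and> continuous_operator L E g \<and>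
      (\<forall>x\<in>topspace X. g (i x) = f x)"
  proof (rule ex1I[of _ h])
    show "h \<in> extensional (topspace L) \<and> continuous_operator L E h \<and>
        (\<forall>x\<in>topspace X. h (i x) = f x)"
      using h hi by (simp add: h_def)
  next
    fix k assume k: "k \<in> extensional (topspace L) \<and> continuous_operator L E k \<and>
        (\<forall>x\<in>topspace X. k (i x) = f x)"
    have "k y = h y" if "y \<in> topspace L" for y
    proof (rule continuous_operator_eq_on_span[of L E k h "i ` topspace X"])
      show "k x = h x" if "x \<in> i ` topspace X" for x using that k hi by auto
      show "y \<in> span (i ` topspace X)"
        using that by (simp flip: free_locally_convex_space_span[OF free])
    qed (use k h iL sub(1) in auto)
    then show "k = h"
      using k by (intro extensionalityI[of _ "topspace L"]) (auto simp: h_def)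
  qed
qed

end

theory Submission
  imports Defs
begin

text \<open>
  A family of continuous functions that is uniformly small, up to finitely many members, on every
  compact set is relatively compact in \<open>C\<^sub>k\<close>; so an Ascoli space contains no strict fan, i.e. no
  open sets \<open>U\<^sub>j\<close>, of which every compact set meets only finitely many, with points \<open>a\<^sub>j \<in> U\<^sub>j\<close>
  clustering at some \<open>z\<close> outside all \<open>U\<^sub>j\<close>.

  If \<open>X\<close> is uncountable and discrete, compact subsets of \<open>L(X)\<close> have finite support, and the points
  \<open>|F|\<^sup>-\<^sup>2 \<cdot> \<Sum>x\<in>F. x\<close>, for finite \<open>F \<subseteq> X\<close>, form a strict fan at \<open>0\<close>.

  If \<open>X\<close> has a non-isolated point, there is a point-finite family of functions \<open>X \<rightarrow> [0, 1]\<close> that is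
  not equicontinuous there. Its linear extensions cannot vanish along every compact subset of
  \<open>L(X)\<close>, which yields functionals \<open>k\<^sub>r\<close> and points \<open>c\<^sub>r\<close> of a compact set \<open>C\<close> that are almost
  biorthogonal. Every element of \<open>L(X)\<close> is annihilated by almost all \<open>k\<^sub>r\<close>, whereas the formal limit of
  \<open>v\<^sub>m = \<Sum>j<m. 2\<^sup>-\<^sup>j c\<^sub>j\<close> would be annihilated by none. If \<open>z\<close> is a cluster point of the \<open>c\<^sub>r\<close>, the points
  \<open>v\<^sub>m / n + n (c\<^sub>m - z)\<close>, for \<open>1 \<le> n \<le> m\<close>, form a strict fan at \<open>0\<close>: a compact set is bounded, so it
  meets only finitely many rows \<open>n\<close>, and infinitely many hits in one row would produce an element
  annihilated by no \<open>k\<^sub>r\<close>.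

  If \<open>X\<close> is countable and discrete, \<open>L(X)\<close> has countable dimension and the finest locally convex
  topology. Compactness of a set in \<open>C\<^sub>k\<close> then allows one to enlarge a compact box coordinate by
  coordinate, and the union of these boxes is a neighbourhood witnessing equicontinuity.
\<close>

section \<open>Compact families of functions\<close>

text \<open>Otherwise each point of \<open>C\<close> has a neighbourhood catching only finitely many
  indices, and a finite subcover would exhaust \<open>J\<close>. Counting indices instead of points
  allows \<open>d\<close> to repeat values.\<close>

lemma compactin_cluster_point:
  assumes C: "compactin Y C" and J: "infinite J" and d: "d ` J \<subseteq> C"
  obtains z where "z \<in> C" "\<And>U. openin Y U \<Longrightarrow> z \<in> U \<Longrightarrow> infinite {j \<in> J. d j \<in> U}"
proof -
  have "\<exists>z\<in>C. \<forall>U. openin Y U \<longrightarrow> z \<in> U \<longrightarrow> infinite {j \<in> J. d j \<in> U}"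
  proof (rule ccontr)
    assume "\<not> ?thesis"
    then have "\<forall>z\<in>C. \<exists>U. openin Y U \<and> z \<in> U \<and> finite {j \<in> J. d j \<in> U}" by blast
    from bchoice[OF this] obtain U
      where U: "\<forall>z\<in>C. openin Y (U z) \<and> z \<in> U z \<and> finite {j \<in> J. d j \<in> U z}" by blast
    have "\<exists>\<F>. finite \<F> \<and> \<F> \<subseteq> U ` C \<and> C \<subseteq> \<Union>\<F>"
    proof (rule compactinD[OF C])
      show "openin Y V" if "V \<in> U ` C" for V using U that by auto
      show "C \<subseteq> \<Union>(U ` C)" using U by auto
    qed
    then obtain \<F> where \<F>: "finite \<F>" "\<F> \<subseteq> U ` C" "C \<subseteq> \<Union>\<F>" by auto
    have "J \<subseteq> (\<Union>V\<in>\<F>. {j \<in> J. d j \<in> V})" using \<F>(3) d by blast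
    moreover have "finite (\<Union>V\<in>\<F>. {j \<in> J. d j \<in> V})"
      using \<F>(1,2) U by (intro finite_UN_I) auto
    ultimately show False using J finite_subset by blast
  qed
  then show ?thesis using that by blast
qed

text \<open>Every neighbourhood of the zero function contains all but finitely many members, so a
  single set of an open cover leaves only finitely many to be covered.\<close>

lemma compactin_compact_open_vanishing_family:
  fixes F :: "'i \<Rightarrow> 'a \<Rightarrow> real"
  assumes cont: "\<And>j. j \<in> J \<Longrightarrow> continuous_map Y euclideanreal (F j)"
    and fin: "\<And>C \<epsilon>. compactin Y C \<Longrightarrow> \<epsilon> > 0 \<Longrightarrow> finite {j \<in> J. \<exists>c\<in>C. \<epsilon> \<le> \<bar>F j c\<bar>}"
  shows "compactin (compact_open_topology Y)
    (insert (restrict (\<lambda>_. 0) (topspace Y)) ((\<lambda>j. restrict (F j) (topspace Y)) ` J))"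
    (is "compactin ?T (insert ?z (?R ` J))")
proof -
  have cr: "continuous_map Y euclideanreal (restrict f (topspace Y))"
    if "continuous_map Y euclideanreal f" for f :: "'a \<Rightarrow> real"
    using that by (rule continuous_map_eq) simp
  \<comment> \<open>This property passes to finite intersections and to unions, so induction on the
    generation of the topology reduces it to the subbase.\<close>
  have cofinite: "?z \<in> V \<longrightarrow> finite {j \<in> J. ?R j \<notin> V}" if "openin ?T V" for V
  proof -
    have "generate_topology_on {{f \<in> extensional (topspace Y).
        continuous_map Y euclideanreal f \<and> f ` K \<subseteq> U} |K U. compactin Y K \<and> open U} V"
      using that unfolding compact_open_topology_def by (rule openin_topology_generated_by)
    then show ?thesis
    proof induction
      case Empty
      show ?case by simp
    next
      case (Int a b)
      show ?case
      proof
        assume "?z \<in> a \<inter> b"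
        then have "finite {j \<in> J. ?R j \<notin> a}" "finite {j \<in> J. ?R j \<notin> b}"
          using Int.IH by blast+
        then have "finite ({j \<in> J. ?R j \<notin> a} \<union> {j \<in> J. ?R j \<notin> b})" by (rule finite_UnI)
        then show "finite {j \<in> J. ?R j \<notin> a \<inter> b}" by (rule rev_finite_subset) blast
      qed
    next
      case (UN K)
      show ?case
      proof
        assume "?z \<in> \<Union>K"
        then obtain k where k: "k \<in> K" "?z \<in> k" by blast
        then have "finite {j \<in> J. ?R j \<notin> k}" using UN.IH by blast
        moreover have "{j \<in> J. ?R j \<notin> \<Union>K} \<subseteq> {j \<in> J. ?R j \<notin> k}" using k by blast
        ultimately show "finite {j \<in> J. ?R j \<notin> \<Union>K}" by (rule rev_finite_subset)
      qed
    next
      case (Basis s)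
      then obtain C U where s: "s = {f \<in> extensional (topspace Y).
          continuous_map Y euclideanreal f \<and> f ` C \<subseteq> U}" and C: "compactin Y C" and U: "open U"
        by blast
      have CY: "C \<subseteq> topspace Y" using C by (rule compactin_subset_topspace)
      show ?case
      proof
        assume z: "?z \<in> s"
        show "finite {j \<in> J. ?R j \<notin> s}"
        \<comment> \<open>For empty \<open>C\<close> the subbasic set is the whole function space,
          and \<open>0 \<in> U\<close> may fail.\<close>
        proof (cases "C = {}")
          case True
          then have "{j \<in> J. ?R j \<notin> s} = {}" using cont cr by (auto simp: s)
          then show ?thesis by (metis finite.emptyI)
        next
          case False
          then have "0 \<in> U" using z CY by (force simp: s)
          then obtain \<epsilon> where \<epsilon>: "\<epsilon> > 0" "ball 0 \<epsilon> \<subseteq> U"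
            using U open_contains_ball by blast
          have "{j \<in> J. ?R j \<notin> s} \<subseteq> {j \<in> J. \<exists>c\<in>C. \<epsilon> \<le> \<bar>F j c\<bar>}"
          proof (rule subsetI, rule ccontr)
            fix j assume j: "j \<in> {j \<in> J. ?R j \<notin> s}" and n: "j \<notin> {j \<in> J. \<exists>c\<in>C. \<epsilon> \<le> \<bar>F j c\<bar>}"
            have "F j c \<in> U" if "c \<in> C" for c
            proof -
              have "\<bar>F j c\<bar> < \<epsilon>" using n j that by force
              then show ?thesis using \<epsilon>(2) by (auto simp: subset_iff)
            qed
            then have "?R j \<in> s" using j cont cr CY by (auto simp: s)
            then show False using j by simp
          qed
          then show ?thesis using fin[OF C \<epsilon>(1)] finite_subset by blast
        qed
      qed
    qed
  qed
  show ?thesis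
    unfolding compactin_def
  proof (intro conjI allI impI)
    show "insert ?z (?R ` J) \<subseteq> topspace ?T"
      using cont cr by (auto simp: topspace_compact_open_topology)
    fix \<U> assume \<U>: "(\<forall>U\<in>\<U>. openin ?T U) \<and> insert ?z (?R ` J) \<subseteq> \<Union>\<U>"
    then obtain V where V: "V \<in> \<U>" "?z \<in> V" by blast
    let ?E = "{j \<in> J. ?R j \<notin> V}"
    have fE: "finite ?E" using cofinite V \<U> by blast
    have "\<forall>j\<in>?E. \<exists>U. U \<in> \<U> \<and> ?R j \<in> U" using \<U> by blast
    from bchoice[OF this] obtain W where W: "\<forall>j\<in>?E. W j \<in> \<U> \<and> ?R j \<in> W j" by blast
    show "\<exists>\<F>. finite \<F> \<and> \<F> \<subseteq> \<U> \<and> insert ?z (?R ` J) \<subseteq> \<Union>\<F>"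
    proof (intro exI conjI)
      show "finite (insert V (W ` ?E))" using fE by simp
    qed (use V W in blast)+
  qed
qed

text \<open>Together with 0 the family is compact in the compact-open topology, hence
  equicontinuous. Restrictions enter only in between, because the function space consists of
  extensional functions.\<close>

lemma ascoli_space_vanishing_family:
  fixes F :: "'i \<Rightarrow> 'a \<Rightarrow> real"
  assumes Y: "ascoli_space Y"
    and cont: "\<And>j. j \<in> J \<Longrightarrow> continuous_map Y euclideanreal (F j)"
    and fin: "\<And>C \<epsilon>. compactin Y C \<Longrightarrow> \<epsilon> > 0 \<Longrightarrow> finite {j \<in> J. \<exists>c\<in>C. \<epsilon> \<le> \<bar>F j c\<bar>}"
    and y: "y \<in> topspace Y" and \<epsilon>: "\<epsilon> > 0"
  obtains U where "openin Y U" "y \<in> U" "\<And>u j. u \<in> U \<Longrightarrow> j \<in> J \<Longrightarrow> \<bar>F j u - F j y\<bar> < \<epsilon>"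
proof -
  let ?K = "insert (restrict (\<lambda>_. 0) (topspace Y)) ((\<lambda>j. restrict (F j) (topspace Y)) ` J)"
  have "equicontinuous_family Y ?K"
    using Y compactin_compact_open_vanishing_family[OF cont fin] unfolding ascoli_space_def by blast
  then obtain U where U: "openin Y U" "y \<in> U" "\<forall>u\<in>U. \<forall>f\<in>?K. \<bar>f u - f y\<bar> < \<epsilon>"
    using y \<epsilon> unfolding equicontinuous_family_def by meson
  have "\<bar>F j u - F j y\<bar> < \<epsilon>" if "u \<in> U" "j \<in> J" for u j
  proof -
    have "u \<in> topspace Y" using U(1) that(1) openin_subset by blast
    moreover have "\<bar>restrict (F j) (topspace Y) u - restrict (F j) (topspace Y) y\<bar> < \<epsilon>"
      using U(3) that by blast
    ultimately show ?thesis using y by simp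
  qed
  then show ?thesis using that U by blast
qed

text \<open>Complete regularity gives bumps that are 1 at \<open>a j\<close> and 0 off
  \<open>U j\<close>. On a compact set almost all of them vanish, so they are equicontinuous at
  \<open>z\<close>, where all are 0; a neighbourhood of \<open>z\<close> on which all are below 1
  omits every \<open>a j\<close>.\<close>

lemma ascoli_space_no_strict_fan:
  assumes Y: "ascoli_space Y"
    and U: "\<And>j. j \<in> J \<Longrightarrow> openin Y (U j)" "\<And>j. j \<in> J \<Longrightarrow> a j \<in> U j" "\<And>j. j \<in> J \<Longrightarrow> z \<notin> U j"
    and fin: "\<And>C. compactin Y C \<Longrightarrow> finite {j \<in> J. C \<inter> U j \<noteq> {}}"
    and z: "z \<in> topspace Y"
  obtains W where "openin Y W" "z \<in> W" "\<And>j. j \<in> J \<Longrightarrow> a j \<notin> W"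
proof -
  have cr: "completely_regular_space Y"
    using Y by (simp add: ascoli_space_def tychonoff_space_def)
  have "\<exists>f::_ \<Rightarrow> real. continuous_map Y euclideanreal f \<and> f (a j) = 0 \<and> (\<forall>y\<in>topspace Y - U j. f y = 1)"
    if "j \<in> J" for j
  proof -
    have "closedin Y (topspace Y - U j)" "a j \<in> topspace Y - (topspace Y - U j)"
      using U[OF that] openin_subset by fastforce+
    then obtain f :: "_ \<Rightarrow> real" where "continuous_map Y (top_of_set {0..1}) f" "f (a j) = 0"
      "f ` (topspace Y - U j) \<subseteq> {1}"
      using cr unfolding completely_regular_space_def by blast
    then show ?thesis
      by (intro exI[of _ f]) (auto simp: continuous_map_in_subtopology)
  qed
  then have "\<forall>j\<in>J. \<exists>f::_ \<Rightarrow> real. continuous_map Y euclideanreal f \<and> f (a j) = 0 \<and>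
      (\<forall>y\<in>topspace Y - U j. f y = 1)" by blast
  from bchoice[OF this] obtain f :: "_ \<Rightarrow> _ \<Rightarrow> real"
    where "\<forall>j\<in>J. continuous_map Y euclideanreal (f j) \<and> f j (a j) = 0 \<and>
      (\<forall>y\<in>topspace Y - U j. f j y = 1)" by blast
  then have f: "\<And>j. j \<in> J \<Longrightarrow> continuous_map Y euclideanreal (f j)"
    "\<And>j. j \<in> J \<Longrightarrow> f j (a j) = 0" "\<And>j y. j \<in> J \<Longrightarrow> y \<in> topspace Y - U j \<Longrightarrow> f j y = 1"
    by blast+
  have vanish: "finite {j \<in> J. \<exists>c\<in>C. \<epsilon> \<le> \<bar>1 - f j c\<bar>}" if "compactin Y C" "\<epsilon> > 0" for C \<epsilon>
  proof (rule finite_subset[OF _ fin[OF that(1)]])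
    show "{j \<in> J. \<exists>c\<in>C. \<epsilon> \<le> \<bar>1 - f j c\<bar>} \<subseteq> {j \<in> J. C \<inter> U j \<noteq> {}}"
    proof clarify
      fix j c assume "j \<in> J" "c \<in> C" "\<epsilon> \<le> \<bar>1 - f j c\<bar>" "C \<inter> U j = {}"
      moreover from this have "c \<in> topspace Y - U j"
        using that(1) compactin_subset_topspace by fastforce
      ultimately have "f j c = 1" using f(3) by blast
      then show False using \<open>\<epsilon> \<le> \<bar>1 - f j c\<bar>\<close> that(2) by simp
    qed
  qed
  have cont: "continuous_map Y euclideanreal (\<lambda>y. 1 - f j y)" if "j \<in> J" for j
    using f(1)[OF that] by (intro continuous_intros) auto
  show ?thesis
  proof (rule ascoli_space_vanishing_family[OF Y, where F = "\<lambda>j y. 1 - f j y" and J = J, OF cont vanish z zero_less_one])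
    fix W assume W: "openin Y W" "z \<in> W"
      "\<And>u j. u \<in> W \<Longrightarrow> j \<in> J \<Longrightarrow> \<bar>(1 - f j u) - (1 - f j z)\<bar> < 1"
    have "a j \<notin> W" if j: "j \<in> J" for j
      using W(3)[OF _ j, of "a j"] f(2)[OF j] f(3)[OF j, of z] U(3)[OF j] z by auto
    with W(1,2) show thesis by (rule that)
  qed
qed


section \<open>Locally convex spaces\<close>

text \<open>Provides the test spaces for the universal property: the reals for a single functional,
  the bounded sequences with supremum norm for countably many functionals at once.\<close>

lemma locally_convex_space_euclidean:
  "locally_convex_space (euclidean :: 'b::real_normed_vector topology)"
  unfolding locally_convex_space_def
proof (intro conjI)
  show "neighbourhood_base_at 0 convex (euclidean :: 'b topology)"
    unfolding neighbourhood_base_at_def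
  proof (intro allI impI, elim conjE)
    fix W :: "'b set" assume "openin euclidean W" "0 \<in> W"
    then obtain e where "e > 0" "ball 0 e \<subseteq> W"
      using open_contains_ball by (metis open_openin)
    then show "\<exists>U V. openin euclidean U \<and> convex V \<and> 0 \<in> U \<and> U \<subseteq> V \<and> V \<subseteq> W"
      by (intro exI[of _ "ball 0 e"]) auto
  qed
qed (auto simp: continuous_map_iff_continuous2 case_prod_unfold simp flip: euclidean_product_topology
    intro!: continuous_intros)

locale lcs =
  fixes L :: "'v::real_vector topology"
  assumes locally_convex: "locally_convex_space L"
begin

lemma subspace_topspace: "subspace (topspace L)"
  using locally_convex by (simp add: locally_convex_space_def)

lemma mem_topspace [simp]:
  "0 \<in> topspace L"
  "x \<in> topspace L \<Longrightarrow> y \<in> topspace L \<Longrightarrow> x + y \<in> topspace L"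
  "x \<in> topspace L \<Longrightarrow> y \<in> topspace L \<Longrightarrow> x - y \<in> topspace L"
  "x \<in> topspace L \<Longrightarrow> c *\<^sub>R x \<in> topspace L"
  "(\<And>j. j \<in> J \<Longrightarrow> f j \<in> topspace L) \<Longrightarrow> sum f J \<in> topspace L"
  using subspace_topspace
  by (auto simp: subspace_0 subspace_add subspace_diff subspace_scale subspace_sum)

lemma continuous_map_vector_add:
  assumes "continuous_map Z L f" "continuous_map Z L g"
  shows "continuous_map Z L (\<lambda>x. f x + g x)"
proof -
  have "continuous_map Z (prod_topology L L) (\<lambda>x. (f x, g x))"
    using assms by (simp add: continuous_map_pairedI)
  then have "continuous_map Z L ((\<lambda>(x, y). x + y) \<circ> (\<lambda>x. (f x, g x)))"
    using locally_convex continuous_map_compose unfolding locally_convex_space_def by blast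
  then show ?thesis by (simp add: comp_def)
qed

lemma continuous_map_scaleR:
  assumes "continuous_map Z euclideanreal a" "continuous_map Z L f"
  shows "continuous_map Z L (\<lambda>x. a x *\<^sub>R f x)"
proof -
  have "continuous_map Z (prod_topology euclideanreal L) (\<lambda>x. (a x, f x))"
    using assms by (simp add: continuous_map_pairedI)
  then have "continuous_map Z L ((\<lambda>(c, x). c *\<^sub>R x) \<circ> (\<lambda>x. (a x, f x)))"
    using locally_convex continuous_map_compose unfolding locally_convex_space_def by blast
  then show ?thesis by (simp add: comp_def)
qed

lemma continuous_map_vector_diff:
  assumes "continuous_map Z L f" "continuous_map Z L g"
  shows "continuous_map Z L (\<lambda>x. f x - g x)"
  using continuous_map_vector_add[OF assms(1) continuous_map_scaleR[of Z "\<lambda>_. -1" g]] assms(2)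
  by simp

lemma convex_neighbourhood:
  assumes "openin L W" "0 \<in> W"
  obtains A D where "openin L A" "convex D" "0 \<in> A" "A \<subseteq> D" "D \<subseteq> W"
  using locally_convex assms unfolding locally_convex_space_def neighbourhood_base_at_def by meson

text \<open>The preimage of \<open>A\<close> under \<open>(c, t) \<mapsto> c + t *\<^sub>R e\<close>
  is open and contains \<open>C \<times> {0}\<close>; the tube lemma gives an interval of
  \<open>t\<close> uniform in \<open>c\<close>.\<close>

lemma compactin_tube:
  assumes C: "compactin L C" and e: "e \<in> topspace L" and A: "openin L A" and sub: "C \<subseteq> A"
  obtains \<delta> where "\<delta> > 0" "\<And>t c. \<bar>t\<bar> < \<delta> \<Longrightarrow> c \<in> C \<Longrightarrow> c + t *\<^sub>R e \<in> A"
proof -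
  let ?P = "prod_topology L euclideanreal"
  let ?g = "\<lambda>p. fst p + snd p *\<^sub>R e"
  have CL: "C \<subseteq> topspace L" using C by (rule compactin_subset_topspace)
  have "continuous_map ?P L ?g"
    using e by (intro continuous_map_vector_add continuous_map_scaleR continuous_map_fst
        continuous_map_snd) auto
  then have "openin ?P {p \<in> topspace ?P. ?g p \<in> A}"
    using A by (rule openin_continuous_map_preimage)
  moreover have "C \<times> {0::real} \<subseteq> {p \<in> topspace ?P. ?g p \<in> A}" using CL sub by auto
  ultimately have "\<exists>U V. openin L U \<and> openin euclideanreal V \<and> C \<subseteq> U \<and> 0 \<in> V \<and>
      U \<times> V \<subseteq> {p \<in> topspace ?P. ?g p \<in> A}"
    using C by (intro tube_lemma_left) auto
  then obtain U V where UV: "openin L U" "openin euclideanreal V" "C \<subseteq> U" "0 \<in> V"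
      "U \<times> V \<subseteq> {p \<in> topspace ?P. ?g p \<in> A}"
    by blast
  then obtain \<delta> where "\<delta> > 0" "ball 0 \<delta> \<subseteq> V"
    using open_contains_ball by (metis open_openin)
  then show ?thesis using UV by (intro that[of \<delta>]) (auto simp: subset_iff)
qed

text \<open>Boundedness of compact sets, by the same tube argument for scalar
  multiplication.\<close>

lemma compactin_absorbed:
  assumes C: "compactin L C" and A: "openin L A" "0 \<in> A"
  obtains \<delta> where "\<delta> > 0" "\<And>t c. \<bar>t\<bar> < \<delta> \<Longrightarrow> c \<in> C \<Longrightarrow> t *\<^sub>R c \<in> A"
proof -
  let ?P = "prod_topology L euclideanreal"
  let ?g = "\<lambda>p. snd p *\<^sub>R fst p"
  have CL: "C \<subseteq> topspace L" using C by (rule compactin_subset_topspace)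
  have "continuous_map ?P L ?g"
    by (intro continuous_map_scaleR continuous_map_fst continuous_map_snd)
  then have "openin ?P {p \<in> topspace ?P. ?g p \<in> A}"
    using A(1) by (rule openin_continuous_map_preimage)
  moreover have "C \<times> {0::real} \<subseteq> {p \<in> topspace ?P. ?g p \<in> A}" using CL A by auto
  ultimately have "\<exists>U V. openin L U \<and> openin euclideanreal V \<and> C \<subseteq> U \<and> 0 \<in> V \<and>
      U \<times> V \<subseteq> {p \<in> topspace ?P. ?g p \<in> A}"
    using C by (intro tube_lemma_left) auto
  then obtain U V where UV: "openin L U" "openin euclideanreal V" "C \<subseteq> U" "0 \<in> V"
      "U \<times> V \<subseteq> {p \<in> topspace ?P. ?g p \<in> A}"
    by blast
  then obtain \<delta> where "\<delta> > 0" "ball 0 \<delta> \<subseteq> V"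
    using open_contains_ball by (metis open_openin)
  then show ?thesis using UV by (intro that[of \<delta>]) (auto simp: subset_iff)
qed

end

section \<open>Free locally convex spaces\<close>

text \<open>The weights \<open>1 / 2 ^ n\<close> make the tail uniformly small, which replaces
  equicontinuity of the \<open>\<kappa> n\<close>; the finitely many other coordinates are
  controlled by intersecting neighbourhoods.\<close>

lemma continuous_map_bcontfun_geometric:
  fixes \<kappa> :: "nat \<Rightarrow> 'a \<Rightarrow> real"
  assumes cont: "\<And>n. continuous_map X euclideanreal (\<kappa> n)"
    and bound: "\<And>n x. x \<in> topspace X \<Longrightarrow> \<bar>\<kappa> n x\<bar> \<le> 1"
  obtains f :: "'a \<Rightarrow> nat \<Rightarrow>\<^sub>C real" where "continuous_map X euclidean f"
    "\<And>n x. x \<in> topspace X \<Longrightarrow> apply_bcontfun (f x) n = \<kappa> n x / 2 ^ n"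
proof -
  define f where "f x = Bcontfun (\<lambda>n. \<kappa> n x / 2 ^ n)" for x
  have f: "apply_bcontfun (f x) n = \<kappa> n x / 2 ^ n" if x: "x \<in> topspace X" for x n
  proof -
    have "norm (\<kappa> n x / 2 ^ n) \<le> 1" for n
    proof -
      have "\<bar>\<kappa> n x\<bar> \<le> 2 ^ n"
        using bound[OF x, of n] one_le_power[of "2::real" n] by linarith
      then show ?thesis by (simp add: divide_le_eq)
    qed
    then have "(\<lambda>n. \<kappa> n x / 2 ^ n) \<in> bcontfun" by (intro bcontfun_normI[where b = 1]) simp_all
    then show ?thesis by (simp add: f_def Bcontfun_inverse)
  qed
  have "continuous_map X Met_TC.mtopology f"
    unfolding Met_TC.continuous_map_to_metric
  proof (intro ballI allI impI)
    fix x and \<epsilon> :: real assume x: "x \<in> topspace X" and \<epsilon>: "0 < \<epsilon>"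
    \<comment> \<open>From index \<open>R\<close> on, weighted values at two points differ by at
      most \<open>2 * (1/2) ^ R\<close>, which is below \<open>\<epsilon> / 2\<close>.\<close>
    obtain R where R: "(1/2) ^ R < \<epsilon> / 4"
      using real_arch_pow_inv[of "\<epsilon>/4" "1/2"] \<epsilon> by auto
    define U where "U = (\<Inter>n\<in>{..<R}. {y \<in> topspace X. \<kappa> n y \<in> ball (\<kappa> n x) (\<epsilon>/2)}) \<inter> topspace X"
    have "openin X {y \<in> topspace X. \<kappa> n y \<in> ball (\<kappa> n x) (\<epsilon>/2)}" for n
      using cont by (rule openin_continuous_map_preimage) simp
    then have "openin X U" unfolding U_def by (intro openin_INT) simp_all
    moreover have "x \<in> U" using x \<epsilon> by (simp add: U_def)
    moreover have "f y \<in> Met_TC.mball (f x) \<epsilon>" if y: "y \<in> U" for y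
    proof -
      have yX: "y \<in> topspace X" using y by (simp add: U_def)
      have "dist (apply_bcontfun (f x) n) (apply_bcontfun (f y) n) \<le> \<epsilon> / 2" for n
      proof -
        have "\<bar>\<kappa> n x - \<kappa> n y\<bar> / 2 ^ n \<le> \<epsilon> / 2"
        proof (cases "n < R")
          case True
          then have "\<bar>\<kappa> n x - \<kappa> n y\<bar> < \<epsilon> / 2" using y by (simp add: U_def dist_real_def)
          moreover have "\<bar>\<kappa> n x - \<kappa> n y\<bar> / 2 ^ n \<le> \<bar>\<kappa> n x - \<kappa> n y\<bar> / 1"
            by (intro divide_left_mono) auto
          ultimately show ?thesis unfolding div_by_1 by linarith
        next
          case False
          have "\<bar>\<kappa> n x - \<kappa> n y\<bar> \<le> 2" using bound[OF x, of n] bound[OF yX, of n] by linarith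
          then have "\<bar>\<kappa> n x - \<kappa> n y\<bar> / 2 ^ n \<le> 2 / 2 ^ n" by (intro divide_right_mono) auto
          also have "\<dots> = 2 * (1/2) ^ n" by (simp add: power_divide)
          also have "\<dots> \<le> 2 * (1/2) ^ R" using False by (intro mult_left_mono power_decreasing) auto
          also have "\<dots> \<le> \<epsilon> / 2" using R by linarith
          finally show ?thesis .
        qed
        then show ?thesis by (simp add: f x yX dist_real_def flip: diff_divide_distrib)
      qed
      then have "dist (f x) (f y) \<le> \<epsilon> / 2" by (rule dist_bound)
      then show ?thesis using \<epsilon> by simp
    qed
    ultimately show "\<exists>U. openin X U \<and> x \<in> U \<and> (\<forall>y\<in>U. f y \<in> Met_TC.mball (f x) \<epsilon>)" by blast
  qed
  then show ?thesis using f by (intro that) auto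
qed

locale free_lcs = lcs L for L :: "'v::real_vector topology" +
  fixes X :: "'a topology" and i :: "'a \<Rightarrow> 'v"
  assumes free: "free_locally_convex_space X L i"
begin

lemma continuous_map_i: "continuous_map X L i"
  using free by (simp add: free_locally_convex_space_def)

lemma i_mem [simp]: "x \<in> topspace X \<Longrightarrow> i x \<in> topspace L"
  using continuous_map_i by (auto simp: continuous_map_def)

lemma topspace_subset_subspace:
  assumes "subspace S" "\<And>x. x \<in> topspace X \<Longrightarrow> i x \<in> S"
  shows "topspace L \<subseteq> S"
  unfolding free_locally_convex_space_span[OF free] using assms by (intro span_minimal) auto

lemma operator_extension:
  fixes E :: "'e::real_vector topology"
  assumes "locally_convex_space E" "continuous_map X E f"
  obtains g where "continuous_operator L E g" "\<And>x. x \<in> topspace X \<Longrightarrow> g (i x) = f x"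
  using free_locally_convex_space_universal[OF free assms(1)] assms(2)
  unfolding extends_uniquely_def by blast

section \<open>Linear extensions of scalar functions\<close>

text \<open>The choice is determined only for continuous \<open>f\<close> and only on
  \<open>topspace L\<close>, so the facts about \<open>lift\<close> carry these two
  hypotheses.\<close>

definition lift :: "('a \<Rightarrow> real) \<Rightarrow> 'v \<Rightarrow> real" where
  "lift f = (SOME g. continuous_operator L euclideanreal g \<and> (\<forall>x\<in>topspace X. g (i x) = f x))"

lemma
  assumes f: "continuous_map X euclideanreal f"
  shows lift_operator: "continuous_operator L euclideanreal (lift f)"
    and lift_i: "x \<in> topspace X \<Longrightarrow> lift f (i x) = f x"
proof -
  obtain g where "continuous_operator L euclideanreal g" "\<And>x. x \<in> topspace X \<Longrightarrow> g (i x) = f x"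
    using operator_extension[OF locally_convex_space_euclidean f] by blast
  then have "continuous_operator L euclideanreal g \<and> (\<forall>x\<in>topspace X. g (i x) = f x)" by blast
  then have "continuous_operator L euclideanreal (lift f) \<and> (\<forall>x\<in>topspace X. lift f (i x) = f x)"
    unfolding lift_def
    by (rule someI[of "\<lambda>g. continuous_operator L euclideanreal g \<and> (\<forall>x\<in>topspace X. g (i x) = f x)"])
  then show "continuous_operator L euclideanreal (lift f)"
    "x \<in> topspace X \<Longrightarrow> lift f (i x) = f x" by blast+
qed

lemma
  assumes f: "continuous_map X euclideanreal f"
  shows continuous_map_lift: "continuous_map L euclideanreal (lift f)"
    and lift_add: "\<And>u v. u \<in> topspace L \<Longrightarrow> v \<in> topspace L \<Longrightarrow> lift f (u + v) = lift f u + lift f v"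
    and lift_scale: "\<And>u c. u \<in> topspace L \<Longrightarrow> lift f (c *\<^sub>R u) = c * lift f u"
  using lift_operator[OF f] by (auto simp: continuous_operator_def)

lemma lift_zero: "continuous_map X euclideanreal f \<Longrightarrow> lift f 0 = 0"
  using lift_scale[of f 0 0] by simp

lemma lift_diff:
  assumes "continuous_map X euclideanreal f" "u \<in> topspace L" "v \<in> topspace L"
  shows "lift f (u - v) = lift f u - lift f v"
  using lift_add[of f u "(-1) *\<^sub>R v"] lift_scale[of f v "-1"] mem_topspace(4)[of v "-1"] assms by simp

lemma lift_sum:
  assumes "continuous_map X euclideanreal f" "\<And>j. j \<in> J \<Longrightarrow> u j \<in> topspace L"
  shows "lift f (\<Sum>j\<in>J. u j) = (\<Sum>j\<in>J. lift f (u j))"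
  using assms(2)
proof (induction J rule: infinite_finite_induct)
  case (insert j J)
  then have "lift f (\<Sum>j\<in>insert j J. u j) = lift f (u j + (\<Sum>j\<in>J. u j))" by simp
  also have "\<dots> = lift f (u j) + lift f (\<Sum>j\<in>J. u j)"
    using insert.prems by (intro lift_add[OF assms(1)]) auto
  finally show ?case using insert by simp
qed (simp_all add: lift_zero assms(1))

lemma lift_unique:
  assumes f: "continuous_map X euclideanreal f" and g: "continuous_operator L euclideanreal g"
    and eq: "\<And>x. x \<in> topspace X \<Longrightarrow> g (i x) = f x" and u: "u \<in> topspace L"
  shows "lift f u = g u"
proof (rule continuous_operator_eq_on_span[OF lift_operator[OF f] g subspace_topspace])
  show "i ` topspace X \<subseteq> topspace L" by auto
  show "u \<in> span (i ` topspace X)" using u free_locally_convex_space_span[OF free] by simp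
qed (auto simp: lift_i[OF f] eq)

lemma lift_cmult:
  assumes f: "continuous_map X euclideanreal f" and u: "u \<in> topspace L"
  shows "lift (\<lambda>x. a * f x) u = a * lift f u"
proof (rule lift_unique[OF _ _ _ u])
  show "continuous_map X euclideanreal (\<lambda>x. a * f x)"
    using f by (intro continuous_intros) auto
  have "continuous_map L euclideanreal (\<lambda>u. a * lift f u)"
    using continuous_map_lift[OF f] by (intro continuous_intros) auto
  then show "continuous_operator L euclideanreal (\<lambda>u. a * lift f u)"
    by (simp add: continuous_operator_def lift_add[OF f] lift_scale[OF f] distrib_left)
qed (simp add: lift_i[OF f])

text \<open>The support of a linear combination lies in the union of the supports, so the vectors of
  finite support form a subspace; point-finiteness puts every \<open>i x\<close> into it.\<close>

lemma finite_lift_support: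
  assumes cont: "\<And>j. j \<in> J \<Longrightarrow> continuous_map X euclideanreal (\<kappa> j)"
    and fin: "\<And>x. x \<in> topspace X \<Longrightarrow> finite {j \<in> J. \<kappa> j x \<noteq> 0}"
    and u: "u \<in> topspace L"
  shows "finite {j \<in> J. lift (\<kappa> j) u \<noteq> 0}"
proof -
  let ?S = "{u \<in> topspace L. finite {j \<in> J. lift (\<kappa> j) u \<noteq> 0}}"
  have "subspace ?S"
  proof (rule subspaceI)
    have "{j \<in> J. lift (\<kappa> j) 0 \<noteq> 0} = {}" using lift_zero cont by auto
    then show "0 \<in> ?S" by (simp only: mem_Collect_eq mem_topspace finite.emptyI)
    show "u + v \<in> ?S" if "u \<in> ?S" "v \<in> ?S" for u v
    proof -
      have "{j \<in> J. lift (\<kappa> j) (u + v) \<noteq> 0} \<subseteq>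
          {j \<in> J. lift (\<kappa> j) u \<noteq> 0} \<union> {j \<in> J. lift (\<kappa> j) v \<noteq> 0}"
        using that lift_add cont by auto
      then show ?thesis using that finite_subset by auto
    qed
    show "c *\<^sub>R u \<in> ?S" if "u \<in> ?S" for c u
    proof -
      have "{j \<in> J. lift (\<kappa> j) (c *\<^sub>R u) \<noteq> 0} \<subseteq> {j \<in> J. lift (\<kappa> j) u \<noteq> 0}"
        using that lift_scale cont by auto
      then show ?thesis using that finite_subset by auto
    qed
  qed
  moreover have "i x \<in> ?S" if x: "x \<in> topspace X" for x
  proof -
    have "{j \<in> J. lift (\<kappa> j) (i x) \<noteq> 0} = {j \<in> J. \<kappa> j x \<noteq> 0}"
      using lift_i[OF cont x] by auto
    then show ?thesis using fin[OF x] x by simp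
  qed
  ultimately have "topspace L \<subseteq> ?S" by (rule topspace_subset_subspace)
  then show ?thesis using u by auto
qed

text \<open>Extend \<open>f\<close> itself to an operator into the bounded sequences. By uniqueness
  its coordinates are the lifts of the coordinates of \<open>f\<close>, so its norm is one
  continuous function bounding all of them.\<close>

lemma lift_dominated:
  fixes f :: "'a \<Rightarrow> nat \<Rightarrow>\<^sub>C real"
  assumes f: "continuous_map X euclidean f"
  obtains P where "continuous_map L euclideanreal P" "P 0 = 0"
    "\<And>u n. u \<in> topspace L \<Longrightarrow> \<bar>lift (\<lambda>x. apply_bcontfun (f x) n) u\<bar> \<le> P u"
proof -
  obtain g where g: "continuous_operator L euclidean g" "\<And>x. x \<in> topspace X \<Longrightarrow> g (i x) = f x"
    using operator_extension[OF locally_convex_space_euclidean f] by blast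
  have ev: "continuous_map euclidean euclideanreal (\<lambda>h :: nat \<Rightarrow>\<^sub>C real. apply_bcontfun h n)" for n
  proof -
    have "bounded_linear (\<lambda>h :: nat \<Rightarrow>\<^sub>C real. apply_bcontfun h n)"
      by (rule bounded_linear_intro[where K = 1]) (use norm_bounded[where 'b = real] in \<open>auto simp flip: real_norm_def\<close>)
    then show ?thesis by (simp add: linear_continuous_on)
  qed
  have gL: "continuous_map L euclidean g" using g(1) by (simp add: continuous_operator_def)
  have "lift (\<lambda>x. apply_bcontfun (f x) n) u = apply_bcontfun (g u) n" if "u \<in> topspace L" for u n
  proof (rule lift_unique[OF _ _ _ that])
    show "continuous_map X euclideanreal (\<lambda>x. apply_bcontfun (f x) n)"
      using continuous_map_compose[OF f ev] by (simp add: comp_def)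
    have "continuous_map L euclideanreal (\<lambda>u. apply_bcontfun (g u) n)"
      using continuous_map_compose[OF gL ev] by (simp add: comp_def)
    then show "continuous_operator L euclideanreal (\<lambda>u. apply_bcontfun (g u) n)"
      using g(1) by (simp add: continuous_operator_def)
  qed (simp add: g(2))
  then have "\<bar>lift (\<lambda>x. apply_bcontfun (f x) n) u\<bar> \<le> norm (g u)" if "u \<in> topspace L" for u n
    using norm_bounded[of "g u" n] that by simp
  moreover have "continuous_map L euclideanreal (\<lambda>u. norm (g u))"
    using gL by (rule continuous_map_norm)
  moreover have "g 0 = 0"
    using g(1) scaleR_zero_left mem_topspace(1) unfolding continuous_operator_def by metis
  ultimately show ?thesis by (intro that[of "\<lambda>u. norm (g u)"]) auto
qed

lemma lift_bounded_on_compact: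
  fixes f :: "'a \<Rightarrow> nat \<Rightarrow>\<^sub>C real"
  assumes f: "continuous_map X euclidean f" and Q: "compactin L Q"
  obtains B where "\<And>q n. q \<in> Q \<Longrightarrow> \<bar>lift (\<lambda>x. apply_bcontfun (f x) n) q\<bar> \<le> B"
proof -
  obtain P where P: "continuous_map L euclideanreal P" "P 0 = 0"
    "\<And>u n. u \<in> topspace L \<Longrightarrow> \<bar>lift (\<lambda>x. apply_bcontfun (f x) n) u\<bar> \<le> P u"
    using f by (rule lift_dominated) blast
  have "bounded (P ` Q)" using image_compactin[OF Q P(1)] by (simp add: compact_imp_bounded)
  then obtain B where B: "\<forall>y\<in>P ` Q. \<bar>y\<bar> \<le> B" unfolding bounded_real by blast
  show ?thesis
  proof (rule that)
    fix q n assume "q \<in> Q"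
    moreover from this have "q \<in> topspace L" using compactin_subset_topspace[OF Q] by blast
    ultimately show "\<bar>lift (\<lambda>x. apply_bcontfun (f x) n) q\<bar> \<le> B"
      using P(3)[of q n] bspec[OF B, of "P q"] by simp
  qed
qed

text \<open>If no bound exists, some values exceed \<open>4 ^ n\<close>. The weights
  \<open>1 / 2 ^ n\<close> turn the chosen functions into one continuous map into the bounded
  sequences, yet leave values above \<open>2 ^ n\<close> on \<open>Q\<close>.\<close>

lemma lift_uniformly_bounded_on_compact:
  assumes cont: "\<And>j. j \<in> J \<Longrightarrow> continuous_map X euclideanreal (\<kappa> j)"
    and bound: "\<And>j x. j \<in> J \<Longrightarrow> x \<in> topspace X \<Longrightarrow> \<bar>\<kappa> j x\<bar> \<le> 1"
    and Q: "compactin L Q"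
  obtains B where "\<And>q j. q \<in> Q \<Longrightarrow> j \<in> J \<Longrightarrow> \<bar>lift (\<kappa> j) q\<bar> \<le> B"
proof -
  have "\<exists>B. \<forall>q\<in>Q. \<forall>j\<in>J. \<bar>lift (\<kappa> j) q\<bar> \<le> B"
  proof (rule ccontr)
    assume *: "\<not> ?thesis"
    have "\<forall>n::nat. \<exists>p. fst p \<in> Q \<and> snd p \<in> J \<and> 4 ^ n < \<bar>lift (\<kappa> (snd p)) (fst p)\<bar>"
    proof
      fix n :: nat
      obtain q j where "q \<in> Q" "j \<in> J" "4 ^ n < \<bar>lift (\<kappa> j) q\<bar>"
        using * by (meson not_le)
      then show "\<exists>p. fst p \<in> Q \<and> snd p \<in> J \<and> 4 ^ n < \<bar>lift (\<kappa> (snd p)) (fst p)\<bar>"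
        by (intro exI[of _ "(q, j)"]) simp
    qed
    from choice[OF this] obtain p
      where p: "\<And>n. fst (p n) \<in> Q" "\<And>n. snd (p n) \<in> J"
        "\<And>n::nat. 4 ^ n < \<bar>lift (\<kappa> (snd (p n))) (fst (p n))\<bar>" by blast
    let ?\<kappa> = "\<lambda>n. \<kappa> (snd (p n))"
    have c: "continuous_map X euclideanreal (?\<kappa> n)" for n using cont p(2) by blast
    obtain f :: "'a \<Rightarrow> nat \<Rightarrow>\<^sub>C real" where f: "continuous_map X euclidean f"
      "\<And>n x. x \<in> topspace X \<Longrightarrow> apply_bcontfun (f x) n = ?\<kappa> n x / 2 ^ n"
      by (rule continuous_map_bcontfun_geometric[of X ?\<kappa>, OF c bound[OF p(2)]]) blast+
    obtain B where B: "\<And>q n. q \<in> Q \<Longrightarrow> \<bar>lift (\<lambda>x. apply_bcontfun (f x) n) q\<bar> \<le> B"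
      using f(1) Q by (rule lift_bounded_on_compact) blast
    have "2 ^ n \<le> B" for n :: nat
    proof -
      let ?q = "fst (p n)"
      have q: "?q \<in> topspace L" using p(1) compactin_subset_topspace[OF Q] by blast
      have op: "continuous_operator L euclideanreal (\<lambda>u. (1 / 2 ^ n) * lift (?\<kappa> n) u)"
        using lift_operator[OF c[of n]] continuous_map_lift[OF c[of n]]
        by (auto simp: continuous_operator_def add_divide_distrib intro!: continuous_intros)
      have "lift (\<lambda>x. apply_bcontfun (f x) n) ?q = (1 / 2 ^ n) * lift (?\<kappa> n) ?q"
      proof (rule lift_unique[OF _ op _ q])
        show "continuous_map X euclideanreal (\<lambda>x. apply_bcontfun (f x) n)"
        proof (rule continuous_map_eq)
          show "continuous_map X euclideanreal (\<lambda>x. (1 / 2 ^ n) * ?\<kappa> n x)"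
            using c[of n] by (intro continuous_intros) auto
        qed (simp add: f(2))
      qed (simp add: f(2) lift_i[OF c])
      then have "\<bar>lift (?\<kappa> n) ?q\<bar> / 2 ^ n \<le> B"
        using B[OF p(1), of n n] by (simp add: abs_mult)
      moreover have "(2::real) ^ n = 4 ^ n / 2 ^ n" by (simp flip: power_divide)
      moreover have "4 ^ n / 2 ^ n \<le> \<bar>lift (?\<kappa> n) ?q\<bar> / 2 ^ n"
        using p(3)[of n] by (intro divide_right_mono) auto
      ultimately show ?thesis by linarith
    qed
    moreover obtain n where "B < 2 ^ n" using real_arch_pow[of 2 B] by auto
    ultimately show False by (metis not_le)
  qed
  then show ?thesis using that by blast
qed

end

section \<open>Uncountable discrete spaces and non-isolated points\<close>

lemma openin_Collect_finite_ball:
  assumes "finite F" "\<And>x. x \<in> F \<Longrightarrow> openin Y {u \<in> topspace Y. P x u}"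
  shows "openin Y {u \<in> topspace Y. \<forall>x\<in>F. P x u}"
proof -
  have "{u \<in> topspace Y. \<forall>x\<in>F. P x u} = (\<Inter>x\<in>F. {u \<in> topspace Y. P x u}) \<inter> topspace Y" by auto
  then show ?thesis using assms by (simp add: openin_INT)
qed

text \<open>Normalise the weights to sum 1 and put the missing mass at 0.\<close>

lemma convex_subunit_sum:
  fixes D :: "'v::real_vector set"
  assumes D: "convex D" "0 \<in> D" and J: "finite J"
    and w: "\<And>j. j \<in> J \<Longrightarrow> 0 \<le> w j" "(\<Sum>j\<in>J. w j) \<le> 1" and y: "\<And>j. j \<in> J \<Longrightarrow> y j \<in> D"
  shows "(\<Sum>j\<in>J. w j *\<^sub>R y j) \<in> D"
proof (cases "(\<Sum>j\<in>J. w j) = 0")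
  case True
  then have "\<forall>j\<in>J. w j = 0" using w(1) J by (simp add: sum_nonneg_eq_0_iff)
  then show ?thesis using D(2) by simp
next
  case False
  define s where "s = (\<Sum>j\<in>J. w j)"
  have s: "0 < s" "s \<le> 1" using False w sum_nonneg[of J w] by (auto simp: s_def)
  have "(\<Sum>j\<in>J. (w j / s) *\<^sub>R y j) \<in> D"
    using D(1) J y s w(1) by (intro convex_sum) (auto simp: s_def simp flip: sum_divide_distrib)
  then have "s *\<^sub>R (\<Sum>j\<in>J. (w j / s) *\<^sub>R y j) + (1 - s) *\<^sub>R 0 \<in> D"
    using D s by (intro convexD) auto
  then show ?thesis using s by (simp add: scaleR_sum_right)
qed

text \<open>Each sequence has finitely many nonzero terms, so it is bounded even when weights grow
  with \<open>n\<close>. Continuity of \<open>f\<close> is automatic in the applications, where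
  \<open>X\<close> is discrete.\<close>

lemma bcontfun_of_point_finite:
  fixes \<kappa> :: "nat \<Rightarrow> 'a \<Rightarrow> real"
  assumes "\<And>x. x \<in> S \<Longrightarrow> finite {n. \<kappa> n x \<noteq> 0}"
  obtains f :: "'a \<Rightarrow> nat \<Rightarrow>\<^sub>C real" where "\<And>x n. x \<in> S \<Longrightarrow> apply_bcontfun (f x) n = \<kappa> n x"
proof
  fix x n assume x: "x \<in> S"
  have "range (\<lambda>n. \<kappa> n x) \<subseteq> insert 0 ((\<lambda>n. \<kappa> n x) ` {n. \<kappa> n x \<noteq> 0})" by auto
  then have "bounded (range (\<lambda>n. \<kappa> n x))"
    using assms[OF x] by (meson bounded_subset finite.insertI finite_imageI finite_imp_bounded)
  then have "(\<lambda>n. \<kappa> n x) \<in> bcontfun" by (simp add: bcontfun_def)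
  then show "apply_bcontfun (Bcontfun (\<lambda>n. \<kappa> n x)) n = \<kappa> n x" by (simp add: Bcontfun_inverse)
qed

text \<open>Zorn's lemma gives a maximal family of functions vanishing at \<open>x0\<close>, at most
  one of them nonzero at each point. If all vanished near \<open>x0\<close>, that neighbourhood
  would contain another point, and a bump there could be added.\<close>

lemma point_finite_family_at_nonisolated_point:
  fixes X :: "'a topology"
  assumes X: "tychonoff_space X" and x0: "x0 \<in> topspace X" "\<not> openin X {x0}"
  obtains J :: "(('a \<Rightarrow> real) \<times> nat) set" and \<kappa> :: "('a \<Rightarrow> real) \<times> nat \<Rightarrow> 'a \<Rightarrow> real"
  where "\<And>j. j \<in> J \<Longrightarrow> continuous_map X euclideanreal (\<kappa> j)"
    "\<And>j x. \<bar>\<kappa> j x\<bar> \<le> 1" "\<And>j. j \<in> J \<Longrightarrow> \<kappa> j x0 = 0"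
    "\<And>x. x \<in> topspace X \<Longrightarrow> finite {j \<in> J. \<kappa> j x \<noteq> 0}"
    "\<And>W. openin X W \<Longrightarrow> x0 \<in> W \<Longrightarrow> \<exists>y\<in>W. \<exists>j\<in>J. 1/2 \<le> \<kappa> j y"
proof -
  define G where "G = {h :: 'a \<Rightarrow> real. continuous_map X euclideanreal h \<and> h x0 = 0 \<and>
    (\<forall>x\<in>topspace X. 0 \<le> h x \<and> h x \<le> 1)}"
  define A where "A = {H. H \<subseteq> G \<and> (\<forall>g\<in>H. \<forall>h\<in>H. g \<noteq> h \<longrightarrow> (\<forall>x\<in>topspace X. g x = 0 \<or> h x = 0))}"
  have "\<Union>C \<in> A" if "subset.chain A C" for C
  proof -
    have CA: "C \<subseteq> A" and ch: "\<And>P Q. P \<in> C \<Longrightarrow> Q \<in> C \<Longrightarrow> P \<subseteq> Q \<or> Q \<subseteq> P"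
      using that by (auto simp: subset_chain_def)
    have "g x = 0 \<or> h x = 0"
      if g: "g \<in> \<Union>C" and h: "h \<in> \<Union>C" and ne: "g \<noteq> h" and x: "x \<in> topspace X" for g h x
    proof -
      obtain P Q where PQ: "P \<in> C" "g \<in> P" "Q \<in> C" "h \<in> Q" using g h by blast
      obtain R where R: "R \<in> C" "g \<in> R" "h \<in> R"
        using ch[OF PQ(1,3)] PQ by blast
      then have "R \<in> A" using CA by blast
      then show ?thesis using R(2,3) ne x unfolding A_def by blast
    qed
    moreover have "\<Union>C \<subseteq> G" using CA unfolding A_def by blast
    ultimately show ?thesis unfolding A_def by blast
  qed
  then obtain H where H: "H \<in> A" and max: "\<And>H'. H' \<in> A \<Longrightarrow> H \<subseteq> H' \<Longrightarrow> H' = H"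
    using subset_Zorn'[of A] by blast
  have HG: "H \<subseteq> G" and disj: "\<And>g h x. g \<in> H \<Longrightarrow> h \<in> H \<Longrightarrow> g \<noteq> h \<Longrightarrow> x \<in> topspace X \<Longrightarrow> g x = 0 \<or> h x = 0"
    using H unfolding A_def by blast+
  have dense: "\<exists>y\<in>W. \<exists>h\<in>H. h y \<noteq> 0" if W: "openin X W" "x0 \<in> W" for W
  proof (rule ccontr)
    assume *: "\<not> ?thesis"
    have "W \<noteq> {x0}" using W x0 by auto
    then obtain y where y: "y \<in> W" "y \<noteq> x0" using W by blast
    have WX: "W \<subseteq> topspace X" using W(1) by (rule openin_subset)
    have "closedin X {x0}"
      using X x0(1) by (simp add: tychonoff_space_def Hausdorff_imp_t1_space closedin_t1_singleton)
    \<comment> \<open>Including \<open>x0\<close> makes the new function vanish at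
      \<open>x0\<close>, as \<open>G\<close> demands; vanishing off \<open>W\<close> makes it
      disjoint from the members of \<open>H\<close>, which vanish on \<open>W\<close>.\<close>
    then have "closedin X ((topspace X - W) \<union> {x0})" using W(1) by blast
    moreover have "y \<in> topspace X - ((topspace X - W) \<union> {x0})" using y WX by blast
    ultimately obtain g :: "'a \<Rightarrow> real" where g: "continuous_map X (top_of_set {0..1}) g" "g y = 0"
        "g ` ((topspace X - W) \<union> {x0}) \<subseteq> {1}"
      using X unfolding tychonoff_space_def completely_regular_space_def by blast
    define h where "h x = 1 - g x" for x
    have gc: "continuous_map X euclideanreal g" and g01: "\<And>x. x \<in> topspace X \<Longrightarrow> g x \<in> {0..1}"
      using g(1) by (auto simp: continuous_map_in_subtopology)
    have "continuous_map X euclideanreal h"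
      unfolding h_def using gc by (intro continuous_intros) auto
    then have "h \<in> G" using g01 g(3) by (auto simp: G_def h_def)
    moreover have "h x = 0 \<or> k x = 0" if "k \<in> H" "x \<in> topspace X" for k x
      using * that g(3) by (cases "x \<in> W") (auto simp: h_def)
    ultimately have "insert h H \<in> A" using H unfolding A_def by blast
    then have "h \<in> H" using max[of "insert h H"] by blast
    moreover have "h y = 1" using g(2) by (simp add: h_def)
    ultimately show False using * y(1) by force
  qed
  text \<open>
    A function \<open>h \<in> H\<close> may be uniformly small near \<open>x\<^sub>0\<close>; composing it with the tents of centre \<open>1 / n\<close>
    gives functions of which one is at least \<open>1 / 2\<close> wherever \<open>h > 0\<close>.
  \<close>
  define J where "J = H \<times> (UNIV :: nat set)"
  define \<kappa> where "\<kappa> = (\<lambda>(h :: 'a \<Rightarrow> real, n :: nat) x. max 0 (1 - \<bar>real n * h x - 1\<bar>))"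
  show ?thesis
  proof (rule that)
    show "continuous_map X euclideanreal (\<kappa> j)" if "j \<in> J" for j
    proof -
      obtain h n where j: "j = (h, n)" by (cases j)
      have "h \<in> H" using that by (simp add: j J_def)
      then have "continuous_map X euclideanreal h" using HG by (auto simp: G_def)
      then show ?thesis unfolding j \<kappa>_def by (auto intro!: continuous_intros)
    qed
    show "\<bar>\<kappa> j x\<bar> \<le> 1" for j x by (auto simp: \<kappa>_def split: prod.split)
    show "\<kappa> j x0 = 0" if "j \<in> J" for j
      using that HG by (auto simp: J_def \<kappa>_def G_def)
    show "finite {j \<in> J. \<kappa> j x \<noteq> 0}" if x: "x \<in> topspace X" for x
    proof (cases "\<exists>h\<in>H. h x \<noteq> 0")
      case False
      then have "{j \<in> J. \<kappa> j x \<noteq> 0} = {}" by (auto simp: J_def \<kappa>_def)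
      then show ?thesis by (simp only: finite.emptyI)
    next
      case True
      then obtain h where h: "h \<in> H" "h x \<noteq> 0" by blast
      then have hx: "0 < h x" using HG x by (force simp: G_def)
      \<comment> \<open>In \<open>H\<close> only \<open>h\<close> is nonzero at \<open>x\<close>,
        and the tent of index \<open>n\<close> vanishes once \<open>n * h x\<close> reaches
        2.\<close>
      have "{j \<in> J. \<kappa> j x \<noteq> 0} \<subseteq> {h} \<times> {..nat \<lceil>2 / h x\<rceil>}"
      proof (rule subsetI)
        fix j assume j: "j \<in> {j \<in> J. \<kappa> j x \<noteq> 0}"
        obtain g n where gn': "j = (g, n)" by (cases j)
        have gn: "(g, n) \<in> J" "\<kappa> (g, n) x \<noteq> 0" using j gn' by auto
        then have "g x \<noteq> 0" "g \<in> H"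
          by (auto simp: \<kappa>_def J_def)
        then have gh: "g = h" using disj[OF _ h(1) _ x] h(2) by blast
        have "real n * h x < 2" using gn(2) by (auto simp: \<kappa>_def gh max_def split: if_splits)
        then have "real n < 2 / h x" using hx by (simp add: pos_less_divide_eq)
        then have "n \<le> nat \<lceil>2 / h x\<rceil>" by linarith
        then show "j \<in> {h} \<times> {..nat \<lceil>2 / h x\<rceil>}" using gh gn' by simp
      qed
      then show ?thesis by (rule finite_subset) simp
    qed
    show "\<exists>y\<in>W. \<exists>j\<in>J. 1/2 \<le> \<kappa> j y" if W: "openin X W" "x0 \<in> W" for W
    proof -
      obtain y h where y: "y \<in> W" "h \<in> H" "h y \<noteq> 0" using dense[OF W] by blast
      have "y \<in> topspace X" using y(1) W(1) openin_subset by blast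
      then have hy: "0 < h y" "h y \<le> 1" using HG y by (force simp: G_def)+
      \<comment> \<open>As \<open>h y \<le> 1\<close>, this \<open>n\<close> is at least 1 and
        \<open>n * h y\<close> lies between 1/2 and 1, where the tent takes the value
        \<open>n * h y\<close>.\<close>
      define n where "n = nat \<lfloor>1 / h y\<rfloor>"
      have "1 \<le> \<lfloor>1 / h y\<rfloor>" using hy by (simp add: le_floor_iff)
      then have "real n = of_int \<lfloor>1 / h y\<rfloor>" "1 \<le> real_of_int \<lfloor>1 / h y\<rfloor>"
        unfolding n_def by (simp_all only: of_nat_nat of_int_1_le_iff)
      then have n: "1 \<le> real n" "real n \<le> 1 / h y" "1 / h y < real n + 1"
        using of_int_floor_le[of "1 / h y"] real_of_int_floor_add_one_gt[of "1 / h y"] by linarith+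
      have t: "real n * h y \<le> 1" using n(2) hy by (simp add: pos_le_divide_eq)
      have "1 < real n * h y + h y" using n(3) hy by (simp add: pos_divide_less_eq distrib_right)
      moreover have "h y \<le> real n * h y" using mult_right_mono[OF n(1), of "h y"] hy by simp
      ultimately have "1/2 \<le> real n * h y" by linarith
      then have "1/2 \<le> \<kappa> (h, n) y" using t by (simp add: \<kappa>_def)
      then show ?thesis using y by (intro bexI[of _ y] bexI[of _ "(h, n)"]) (auto simp: J_def)
    qed
  qed
qed

context free_lcs
begin

lemma openin_lift:
  assumes "continuous_map X euclideanreal f" "open V"
  shows "openin L {u \<in> topspace L. lift f u \<in> V}"
  using continuous_map_lift[OF assms(1)] assms(2) by (simp add: openin_continuous_map_preimage)

section \<open>The uncountable discrete case\<close>

text \<open>An infinite support yields distinct points \<open>e n\<close> and vectors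
  \<open>q n\<close> in \<open>Q\<close> with nonzero coordinate at \<open>e n\<close>. On a
  discrete space arbitrary weights keep the map into the bounded sequences continuous, so the
  weighted coordinates would have to be bounded on \<open>Q\<close>.\<close>

lemma finite_support_of_compactin_discrete:
  assumes X: "X = discrete_topology (topspace X)" and Q: "compactin L Q"
  shows "finite {x \<in> topspace X. \<exists>q\<in>Q. lift (indicat_real {x}) q \<noteq> 0}" (is "finite ?S")
proof (rule ccontr)
  have cont: "continuous_map X euclideanreal f" for f :: "'a \<Rightarrow> real" by (subst X) simp
  assume "infinite ?S"
  then obtain e :: "nat \<Rightarrow> 'a" where e: "inj e" "range e \<subseteq> ?S"
    using infinite_countable_subset by blast
  have "\<forall>n. \<exists>q. q \<in> Q \<and> lift (indicat_real {e n}) q \<noteq> 0" using e(2) by blast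
  from choice[OF this] obtain q where q: "\<And>n. q n \<in> Q" "\<And>n. lift (indicat_real {e n}) (q n) \<noteq> 0"
    by blast
  have qL: "q n \<in> topspace L" for n using q(1) compactin_subset_topspace[OF Q] by blast
  \<comment> \<open>Gives the weighted coordinate of \<open>q n\<close> at \<open>e n\<close> the
    absolute value \<open>n + 1\<close>.\<close>
  define w where "w n = real (n + 1) / \<bar>lift (indicat_real {e n}) (q n)\<bar>" for n
  have pf: "finite {n. w n * indicat_real {e n} x \<noteq> 0}" for x
  proof (rule finite_subset)
    show "{n. w n * indicat_real {e n} x \<noteq> 0} \<subseteq> e -` {x}" by (auto simp: indicator_def)
    show "finite (e -` {x})" using e(1) by (simp add: finite_vimageI)
  qed
  obtain f :: "'a \<Rightarrow> nat \<Rightarrow>\<^sub>C real"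
    where f: "\<And>x n. x \<in> UNIV \<Longrightarrow> apply_bcontfun (f x) n = w n * indicat_real {e n} x"
    by (rule bcontfun_of_point_finite[where S = UNIV and \<kappa> = "\<lambda>n x. w n * indicat_real {e n} x", OF pf]) blast+
  have "continuous_map X euclidean f" by (subst X) simp
  then obtain B where B: "\<And>q n. q \<in> Q \<Longrightarrow> \<bar>lift (\<lambda>x. apply_bcontfun (f x) n) q\<bar> \<le> B"
    using Q by (rule lift_bounded_on_compact) blast
  have "real (n + 1) \<le> B" for n
  proof -
    have "\<bar>w n * lift (indicat_real {e n}) (q n)\<bar> \<le> B"
      using B[OF q(1), of n n] by (simp add: f lift_cmult[OF cont qL])
    then show ?thesis using q(2)[of n] by (simp add: w_def abs_mult)
  qed
  moreover obtain n where "B < real n" using reals_Archimedean2 by blast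
  moreover have "real n \<le> real (n + 1)" by simp
  ultimately show False by (meson le_less_trans less_le_not_le order_trans)
qed

lemma ascoli_discrete_imp_countable:
  assumes X: "X = discrete_topology (topspace X)" and L: "ascoli_space L"
  shows "countable (topspace X)"
proof (rule ccontr)
  assume unc: "uncountable (topspace X)"
  have cont: "continuous_map X euclideanreal f" for f :: "'a \<Rightarrow> real" by (subst X) simp
  define k where "k x = lift (indicat_real {x})" for x
  define J where "J = {F. F \<subseteq> topspace X \<and> finite F \<and> F \<noteq> {}}"
  \<comment> \<open>The threshold is half the coordinate of \<open>a F\<close> at each point of
    \<open>F\<close>. Vectors in \<open>U F\<close> have all of \<open>F\<close> in their support,
    so a compact set meets \<open>U F\<close> only for subsets \<open>F\<close> of its finite
    support.\<close>
  define U where "U F = {u \<in> topspace L. \<forall>x\<in>F. k x u \<in> {1 / (2 * (real (card F))\<^sup>2)<..}}" for F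
  define a where "a F = (1 / (real (card F))\<^sup>2) *\<^sub>R (\<Sum>x\<in>F. i x)" for F
  have "openin L (U F)" if "F \<in> J" for F
    unfolding U_def k_def using that
    by (intro openin_Collect_finite_ball openin_lift cont) (auto simp: J_def)
  moreover have "a F \<in> U F" if F: "F \<in> J" for F
  proof -
    have FX: "F \<subseteq> topspace X" and fF: "finite F" and c: "0 < card F"
      using F by (auto simp: J_def card_gt_0_iff)
    have s: "(\<Sum>x\<in>F. i x) \<in> topspace L" using FX by (intro mem_topspace(5) i_mem) auto
    have "k x (a F) = 1 / (real (card F))\<^sup>2" if x: "x \<in> F" for x
    proof -
      have "k x (\<Sum>y\<in>F. i y) = (\<Sum>y\<in>F. k x (i y))"
        unfolding k_def using FX by (intro lift_sum cont) auto
      also have "\<dots> = (\<Sum>y\<in>F. if y = x then 1 else 0)"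
        using FX by (intro sum.cong) (auto simp: k_def lift_i[OF cont] indicator_def)
      also have "\<dots> = 1" using x fF by simp
      finally show ?thesis using lift_scale[OF cont s] by (simp add: a_def k_def)
    qed
    moreover have "1 / (2 * (real (card F))\<^sup>2) < 1 / (real (card F))\<^sup>2"
      using c by (simp add: field_simps)
    moreover have "a F \<in> topspace L" using s by (simp add: a_def)
    ultimately show ?thesis by (simp add: U_def)
  qed
  moreover have "0 \<notin> U F" if F: "F \<in> J" for F
  proof -
    obtain x where x: "x \<in> F" using F unfolding J_def by blast
    have "k x 0 = 0" by (simp add: k_def lift_zero[OF cont])
    then have "k x 0 \<notin> {1 / (2 * (real (card F))\<^sup>2)<..}" by (simp add: not_less)
    then show ?thesis using x unfolding U_def by blast
  qed
  moreover have "finite {F \<in> J. Q \<inter> U F \<noteq> {}}" if Q: "compactin L Q" for Q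
  proof (rule finite_subset)
    show "finite (Pow {x \<in> topspace X. \<exists>q\<in>Q. lift (indicat_real {x}) q \<noteq> 0})"
      using finite_support_of_compactin_discrete[OF X Q] by simp
    show "{F \<in> J. Q \<inter> U F \<noteq> {}} \<subseteq> Pow {x \<in> topspace X. \<exists>q\<in>Q. lift (indicat_real {x}) q \<noteq> 0}"
    proof (intro subsetI PowI)
      fix F x assume F': "F \<in> {F \<in> J. Q \<inter> U F \<noteq> {}}" and x: "x \<in> F"
      then obtain q where F: "F \<in> J" and q: "q \<in> Q" "q \<in> U F" by blast
      have "1 / (2 * (real (card F))\<^sup>2) < k x q" using q(2) x by (simp add: U_def)
      moreover have "0 \<le> 1 / (2 * (real (card F))\<^sup>2)" by simp
      ultimately have "k x q \<noteq> 0" by linarith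
      then show "x \<in> {x \<in> topspace X. \<exists>q\<in>Q. lift (indicat_real {x}) q \<noteq> 0}"
        using F x q(1) by (auto simp: J_def k_def)
    qed
  qed
  ultimately obtain W where W: "openin L W" "0 \<in> W" "\<And>F. F \<in> J \<Longrightarrow> a F \<notin> W"
    by (rule ascoli_space_no_strict_fan[OF L, of J U a 0]) auto
  obtain A D where AD: "openin L A" "convex D" "0 \<in> A" "A \<subseteq> D" "D \<subseteq> W"
    using W(1,2) by (rule convex_neighbourhood)
  have "\<exists>\<delta>. 0 < \<delta> \<and> (\<forall>t. \<bar>t\<bar> < \<delta> \<longrightarrow> t *\<^sub>R i x \<in> A)" if x: "x \<in> topspace X" for x
  proof -
    have "compactin L {i x}" using x by simp
    then obtain \<delta> where "\<delta> > 0" "\<And>t c. \<bar>t\<bar> < \<delta> \<Longrightarrow> c \<in> {i x} \<Longrightarrow> t *\<^sub>R c \<in> A"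
      using AD(1,3) by (rule compactin_absorbed) blast
    then show ?thesis by blast
  qed
  then have "\<forall>x\<in>topspace X. \<exists>\<delta>. 0 < \<delta> \<and> (\<forall>t. \<bar>t\<bar> < \<delta> \<longrightarrow> t *\<^sub>R i x \<in> A)" by blast
  from bchoice[OF this] obtain \<delta> where \<delta>: "\<And>x. x \<in> topspace X \<Longrightarrow> 0 < \<delta> x"
    "\<And>x t. x \<in> topspace X \<Longrightarrow> \<bar>t\<bar> < \<delta> x \<Longrightarrow> t *\<^sub>R i x \<in> A" by blast
  have "topspace X \<subseteq> (\<Union>N::nat. {x \<in> topspace X. 1 / real (Suc N) < \<delta> x})"
  proof
    fix x assume x: "x \<in> topspace X"
    obtain N where "1 / real (Suc N) < \<delta> x" using \<delta>(1)[OF x] by (rule nat_approx_posE)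
    then show "x \<in> (\<Union>N. {x \<in> topspace X. 1 / real (Suc N) < \<delta> x})" using x by blast
  qed
  \<comment> \<open>Pigeonhole: countably many pieces cover an uncountable set, so one scale
    \<open>1 / Suc N\<close> works for infinitely many points, in particular for
    \<open>Suc N\<close> of them.\<close>
  then have "uncountable (\<Union>N::nat. {x \<in> topspace X. 1 / real (Suc N) < \<delta> x})"
    using unc countable_subset by blast
  then have "\<exists>N::nat. infinite {x \<in> topspace X. 1 / real (Suc N) < \<delta> x}"
    by (auto intro: countable_finite)
  then obtain N :: nat where N: "infinite {x \<in> topspace X. 1 / real (Suc N) < \<delta> x}" by blast
  obtain F where F: "finite F" "card F = Suc N" "F \<subseteq> {x \<in> topspace X. 1 / real (Suc N) < \<delta> x}"
    using infinite_arbitrarily_large[OF N] by blast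
  have FJ: "F \<in> J" using F by (auto simp: J_def)
  \<comment> \<open>The square in \<open>a F\<close> makes it the mean of \<open>Suc N\<close>
    vectors, each of them \<open>i x\<close> scaled by \<open>1 / Suc N\<close> and hence in
    \<open>D\<close>.\<close>
  have "(\<Sum>x\<in>F. (1 / real (Suc N)) *\<^sub>R ((1 / real (Suc N)) *\<^sub>R i x)) \<in> D"
  proof (rule convex_sum[OF F(1) AD(2)])
    show "(\<Sum>x\<in>F. 1 / real (Suc N)) = 1" using F(2) by simp
    show "(1 / real (Suc N)) *\<^sub>R i x \<in> D" if "x \<in> F" for x
      using \<delta>(2)[of x "1 / real (Suc N)"] that F(3) AD(4) by auto
  qed simp
  moreover have "(\<Sum>x\<in>F. (1 / real (Suc N)) *\<^sub>R ((1 / real (Suc N)) *\<^sub>R i x)) = a F"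
    unfolding a_def F(2) by (simp only: scaleR_sum_right scaleR_scaleR power2_eq_square times_divide_times_eq mult_1)
  ultimately show False using W(3)[OF FJ] AD(5) by auto
qed

section \<open>The case of a non-isolated point\<close>

text \<open>If the lifts vanished along every compact set, they would be equicontinuous at
  \<open>i x0\<close>. Pulled back along \<open>i\<close>, this contradicts the values 1/2 taken
  arbitrarily near \<open>x0\<close>. The final index set keeps only the lifts reaching
  \<open>\<epsilon>\<close> on \<open>C\<close>.\<close>

lemma ascoli_infinite_on_compact:
  assumes X: "tychonoff_space X" and x0: "x0 \<in> topspace X" "\<not> openin X {x0}"
    and L: "ascoli_space L"
  obtains J :: "(('a \<Rightarrow> real) \<times> nat) set" and \<kappa> :: "('a \<Rightarrow> real) \<times> nat \<Rightarrow> 'a \<Rightarrow> real" and C \<epsilon>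
  where "\<And>j. j \<in> J \<Longrightarrow> continuous_map X euclideanreal (\<kappa> j)"
    "\<And>j x. \<bar>\<kappa> j x\<bar> \<le> 1" "\<And>x. x \<in> topspace X \<Longrightarrow> finite {j \<in> J. \<kappa> j x \<noteq> 0}"
    "compactin L C" "\<epsilon> > 0" "infinite J" "\<And>j. j \<in> J \<Longrightarrow> \<exists>c\<in>C. \<epsilon> \<le> \<bar>lift (\<kappa> j) c\<bar>"
proof -
  obtain J :: "(('a \<Rightarrow> real) \<times> nat) set" and \<kappa>
    where cont: "\<And>j. j \<in> J \<Longrightarrow> continuous_map X euclideanreal (\<kappa> j)"
      and bound: "\<And>j x. \<bar>\<kappa> j x\<bar> \<le> 1" and zero: "\<And>j. j \<in> J \<Longrightarrow> \<kappa> j x0 = 0"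
      and pf: "\<And>x. x \<in> topspace X \<Longrightarrow> finite {j \<in> J. \<kappa> j x \<noteq> 0}"
      and half: "\<And>W. openin X W \<Longrightarrow> x0 \<in> W \<Longrightarrow> \<exists>y\<in>W. \<exists>j\<in>J. 1/2 \<le> \<kappa> j y"
    using X x0 by (rule point_finite_family_at_nonisolated_point) blast
  have "\<exists>C \<epsilon>. compactin L C \<and> \<epsilon> > 0 \<and> infinite {j \<in> J. \<exists>c\<in>C. \<epsilon> \<le> \<bar>lift (\<kappa> j) c\<bar>}"
  proof (rule ccontr)
    assume "\<not> ?thesis"
    then have fin: "finite {j \<in> J. \<exists>c\<in>C. \<epsilon> \<le> \<bar>lift (\<kappa> j) c\<bar>}" if "compactin L C" "\<epsilon> > 0" for C \<epsilon>
      using that by blast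
    have half_pos: "(0::real) < 1/2" by simp
    obtain U where U: "openin L U" "i x0 \<in> U"
      "\<And>u j. u \<in> U \<Longrightarrow> j \<in> J \<Longrightarrow> \<bar>lift (\<kappa> j) u - lift (\<kappa> j) (i x0)\<bar> < 1/2"
      by (rule ascoli_space_vanishing_family[OF L, of J "\<lambda>j. lift (\<kappa> j)",
            OF continuous_map_lift[OF cont] fin i_mem[OF x0(1)] half_pos]) blast+
    have "openin X {x \<in> topspace X. i x \<in> U}"
      using continuous_map_i U(1) by (rule openin_continuous_map_preimage)
    moreover have "x0 \<in> {x \<in> topspace X. i x \<in> U}" using x0(1) U(2) by simp
    ultimately obtain y j where y: "y \<in> topspace X" "i y \<in> U" and j: "j \<in> J" "1/2 \<le> \<kappa> j y"
      using half by blast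
    have "\<bar>\<kappa> j y - \<kappa> j x0\<bar> < 1/2"
      using U(3)[OF y(2) j(1)] lift_i[OF cont[OF j(1)]] y(1) x0(1) by simp
    then show False using zero[OF j(1)] j(2) by simp
  qed
  then obtain C \<epsilon> where C: "compactin L C" "\<epsilon> > 0" "infinite {j \<in> J. \<exists>c\<in>C. \<epsilon> \<le> \<bar>lift (\<kappa> j) c\<bar>}"
    by blast
  show ?thesis
  proof (rule that[of "{j \<in> J. \<exists>c\<in>C. \<epsilon> \<le> \<bar>lift (\<kappa> j) c\<bar>}" \<kappa> C \<epsilon>])
    show "finite {j \<in> {j \<in> J. \<exists>c\<in>C. \<epsilon> \<le> \<bar>lift (\<kappa> j) c\<bar>}. \<kappa> j x \<noteq> 0}" if "x \<in> topspace X" for x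
      by (rule finite_subset[OF _ pf[OF that]]) blast
  qed (use C cont bound in blast)+
qed

text \<open>Let \<open>z\<close> be a cluster point of vectors \<open>d j\<close> in
  \<open>C\<close> on which the lifts reach \<open>\<epsilon>\<close>. Recursively, almost all
  \<open>j\<close> annihilate \<open>z\<close> and the earlier vectors, while infinitely many
  \<open>d j\<close> lie so near \<open>z\<close> that the earlier functionals, which annihilate
  \<open>z\<close>, are small on them.\<close>

lemma ascoli_almost_biorthogonal_sequence:
  fixes \<eta> :: "nat \<Rightarrow> real"
  assumes X: "tychonoff_space X" and x0: "x0 \<in> topspace X" "\<not> openin X {x0}"
    and L: "ascoli_space L" and \<eta>: "\<And>r. 0 < \<eta> r"
  obtains \<kappa> :: "nat \<Rightarrow> 'a \<Rightarrow> real" and c :: "nat \<Rightarrow> 'v" and C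
  where "\<And>r. continuous_map X euclideanreal (\<kappa> r)" "\<And>r x. \<bar>\<kappa> r x\<bar> \<le> 1"
    "\<And>x. x \<in> topspace X \<Longrightarrow> finite {r. \<kappa> r x \<noteq> 0}" "compactin L C" "\<And>r. c r \<in> C"
    "\<And>r. 1 \<le> \<bar>lift (\<kappa> r) (c r)\<bar>" "\<And>l r. r < l \<Longrightarrow> lift (\<kappa> l) (c r) = 0"
    "\<And>l r. l < r \<Longrightarrow> \<bar>lift (\<kappa> l) (c r)\<bar> \<le> \<eta> r"
proof -
  obtain J :: "(('a \<Rightarrow> real) \<times> nat) set" and \<kappa> C \<epsilon>
    where cont: "\<And>j. j \<in> J \<Longrightarrow> continuous_map X euclideanreal (\<kappa> j)"
      and bound: "\<And>j x. \<bar>\<kappa> j x\<bar> \<le> 1"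
      and pf: "\<And>x. x \<in> topspace X \<Longrightarrow> finite {j \<in> J. \<kappa> j x \<noteq> 0}"
      and C: "compactin L C" and \<epsilon>: "\<epsilon> > 0" and J: "infinite J"
      and ex: "\<And>j. j \<in> J \<Longrightarrow> \<exists>c\<in>C. \<epsilon> \<le> \<bar>lift (\<kappa> j) c\<bar>"
    using X x0 L by (rule ascoli_infinite_on_compact) blast
  have CL: "u \<in> topspace L" if "u \<in> C" for u using that compactin_subset_topspace[OF C] by blast
  have "\<forall>j\<in>J. \<exists>c. c \<in> C \<and> \<epsilon> \<le> \<bar>lift (\<kappa> j) c\<bar>" using ex by blast
  from bchoice[OF this] obtain d
    where d: "\<And>j. j \<in> J \<Longrightarrow> d j \<in> C" "\<And>j. j \<in> J \<Longrightarrow> \<epsilon> \<le> \<bar>lift (\<kappa> j) (d j)\<bar>" by blast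
  have "d ` J \<subseteq> C" using d(1) by blast
  then obtain z where z: "z \<in> C" "\<And>U. openin L U \<Longrightarrow> z \<in> U \<Longrightarrow> infinite {j \<in> J. d j \<in> U}"
    by (rule compactin_cluster_point[OF C J]) blast
  have supp: "finite {j \<in> J. lift (\<kappa> j) u \<noteq> 0}" if "u \<in> C" for u
    using cont pf CL[OF that] by (rule finite_lift_support)
  \<comment> \<open>The condition at \<open>z\<close> is carried along so that at every later stage
    the set \<open>?U\<close> below is a neighbourhood of \<open>z\<close>.\<close>
  define P where "P s r j \<longleftrightarrow> j \<in> J \<and> lift (\<kappa> j) z = 0 \<and>
      (\<forall>q<r. lift (\<kappa> j) (d (s q)) = 0 \<and> \<bar>lift (\<kappa> (s q)) (d j)\<bar> < \<epsilon> * \<eta> r)"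
    for s :: "nat \<Rightarrow> ('a \<Rightarrow> real) \<times> nat" and r j
  have "\<exists>s. \<forall>r. P s r (s r)"
  proof (rule dependent_wellorder_choice)
    show "P f r j = P g r j" if "\<And>q. q < r \<Longrightarrow> f q = g q" for j f g r
      unfolding P_def using that by auto
    fix r s assume IH: "\<And>q. q < r \<Longrightarrow> P s q (s q)"
    then have s: "s q \<in> J" "lift (\<kappa> (s q)) z = 0" if "q < r" for q
      using that unfolding P_def by blast+
    let ?U = "{u \<in> topspace L. \<forall>q\<in>{..<r}. lift (\<kappa> (s q)) u \<in> ball 0 (\<epsilon> * \<eta> r)}"
    have "openin L ?U"
      using s(1) by (intro openin_Collect_finite_ball openin_lift cont) auto
    moreover have "z \<in> ?U" using CL[OF z(1)] s(2) \<epsilon> \<eta>[of r] by simp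
    ultimately have inf: "infinite {j \<in> J. d j \<in> ?U}" by (rule z(2))
    have "finite ({j \<in> J. lift (\<kappa> j) z \<noteq> 0} \<union> (\<Union>q\<in>{..<r}. {j \<in> J. lift (\<kappa> j) (d (s q)) \<noteq> 0}))"
      using supp[OF z(1)] supp[OF d(1)[OF s(1)]] by simp
    from Diff_infinite_finite[OF this inf]
    obtain j where "j \<in> {j \<in> J. d j \<in> ?U} -
        ({j \<in> J. lift (\<kappa> j) z \<noteq> 0} \<union> (\<Union>q\<in>{..<r}. {j \<in> J. lift (\<kappa> j) (d (s q)) \<noteq> 0}))"
      by (metis (lifting) ex_in_conv infinite_imp_nonempty)
    then have "P s r j" unfolding P_def by auto
    then show "\<exists>j. P s r j" ..
  qed
  then obtain s where s: "\<And>r. P s r (s r)" by blast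
  have sJ: "s r \<in> J" for r using s[of r] unfolding P_def by blast
  have s1: "lift (\<kappa> (s l)) (d (s r)) = 0" if "r < l" for l r
    using s[of l] that unfolding P_def by blast
  have s2: "\<bar>lift (\<kappa> (s l)) (d (s r))\<bar> < \<epsilon> * \<eta> r" if "l < r" for l r
    using s[of r] that unfolding P_def by blast
  have s3: "\<epsilon> \<le> \<bar>lift (\<kappa> (s r)) (d (s r))\<bar>" for r using d(2)[OF sJ] .
  \<comment> \<open>Transfers point-finiteness from the indices \<open>j\<close> to the positions
    \<open>r\<close>.\<close>
  have "inj s"
  proof (rule linorder_injI)
    fix q r :: nat assume "q < r"
    then have "lift (\<kappa> (s r)) (d (s q)) = 0" by (rule s1)
    then show "s q \<noteq> s r" using s3[of q] \<epsilon> by auto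
  qed
  \<comment> \<open>Dividing by \<open>\<epsilon>\<close> turns the diagonal bound
    \<open>\<epsilon>\<close> into 1 and the error \<open>\<epsilon> * \<eta> r\<close> into
    \<open>\<eta> r\<close>.\<close>
  let ?c = "\<lambda>r. (1 / \<epsilon>) *\<^sub>R d (s r)"
  have lc: "lift (\<kappa> (s l)) (?c r) = lift (\<kappa> (s l)) (d (s r)) / \<epsilon>" for l r
    using lift_scale[OF cont[OF sJ] CL[OF d(1)[OF sJ]]] by simp
  show ?thesis
  proof (rule that[of "\<lambda>r. \<kappa> (s r)" "(\<lambda>u. (1 / \<epsilon>) *\<^sub>R u) ` C" ?c])
    show "continuous_map X euclideanreal (\<kappa> (s r))" for r using cont[OF sJ] .
    show "\<bar>\<kappa> (s r) x\<bar> \<le> 1" for r x by (rule bound)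
    show "finite {r. \<kappa> (s r) x \<noteq> 0}" if "x \<in> topspace X" for x
    proof -
      have "{r. \<kappa> (s r) x \<noteq> 0} = s -` {j \<in> J. \<kappa> j x \<noteq> 0}" using sJ by auto
      then show ?thesis by (simp only: finite_vimageI[OF pf[OF that] \<open>inj s\<close>])
    qed
    show "compactin L ((\<lambda>u. (1 / \<epsilon>) *\<^sub>R u) ` C)"
      using C by (rule image_compactin) (intro continuous_map_scaleR, auto)
    show "?c r \<in> (\<lambda>u. (1 / \<epsilon>) *\<^sub>R u) ` C" for r using d(1)[OF sJ] by blast
    show "1 \<le> \<bar>lift (\<kappa> (s r)) (?c r)\<bar>" for r
      using s3[of r] \<epsilon> by (simp add: lc abs_divide)
    show "lift (\<kappa> (s l)) (?c r) = 0" if "r < l" for l r using s1[OF that] by (simp add: lc)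
    show "\<bar>lift (\<kappa> (s l)) (?c r)\<bar> \<le> \<eta> r" if "l < r" for l r
      using s2[OF that] \<epsilon> by (simp add: lc abs_divide divide_le_eq mult.commute)
  qed
qed

lemma ascoli_imp_openin_singleton:
  assumes X: "tychonoff_space X" and L: "ascoli_space L" and x0: "x0 \<in> topspace X"
  shows "openin X {x0}"
proof (rule ccontr)
  assume no: "\<not> openin X {x0}"
  \<comment> \<open>The geometric factor keeps the off-diagonal errors in \<open>k l (v m)\<close>
    below half the diagonal term; the square absorbs the coefficient \<open>n \<le> m\<close> of
    \<open>c m\<close> in \<open>a n m\<close>.\<close>
  define \<eta> :: "nat \<Rightarrow> real" where "\<eta> r = (1/2) ^ r / (4 * (real r + 1)\<^sup>2)" for r
  have \<eta>: "0 < \<eta> r" for r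
  proof -
    have "0 < 4 * (real r + 1)\<^sup>2" by (simp add: add_pos_nonneg)
    then show ?thesis unfolding \<eta>_def by (rule divide_pos_pos[rotated]) simp
  qed
  have \<eta>_le: "\<eta> r \<le> (1/2) ^ r / 4" for r
  proof -
    have "1 \<le> (real r + 1)\<^sup>2" by (rule one_le_power) simp
    then show ?thesis unfolding \<eta>_def by (intro divide_left_mono) auto
  qed
  have \<eta>_le_n: "real n * \<eta> m \<le> (1/2) ^ m / (4 * real n)" if "1 \<le> n" "n \<le> m" for n m
  proof -
    have "(real n)\<^sup>2 \<le> (real m + 1)\<^sup>2" using that by (intro power_mono) auto
    moreover have "0 < (real n)\<^sup>2" using that by simp
    ultimately have "(1/2) ^ m / (4 * (real m + 1)\<^sup>2) \<le> (1/2) ^ m / (4 * (real n)\<^sup>2)"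
      by (intro divide_left_mono mult_left_mono mult_pos_pos) auto
    then have "real n * \<eta> m \<le> real n * ((1/2) ^ m / (4 * (real n)\<^sup>2))"
      unfolding \<eta>_def by (intro mult_left_mono) auto
    also have "\<dots> = (1/2) ^ m / (4 * real n)" using that by (simp add: power2_eq_square)
    finally show ?thesis .
  qed
  obtain \<kappa> :: "nat \<Rightarrow> 'a \<Rightarrow> real" and c C
    where cont: "\<And>r. continuous_map X euclideanreal (\<kappa> r)" and bound: "\<And>r x. \<bar>\<kappa> r x\<bar> \<le> 1"
      and pf: "\<And>x. x \<in> topspace X \<Longrightarrow> finite {r. \<kappa> r x \<noteq> 0}"
      and C: "compactin L C" and c: "\<And>r. c r \<in> C"
      and diag: "\<And>r. 1 \<le> \<bar>lift (\<kappa> r) (c r)\<bar>"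
      and upper: "\<And>l r. r < l \<Longrightarrow> lift (\<kappa> l) (c r) = 0"
      and lower: "\<And>l r. l < r \<Longrightarrow> \<bar>lift (\<kappa> l) (c r)\<bar> \<le> \<eta> r"
    by (rule ascoli_almost_biorthogonal_sequence[OF X x0 no L, of \<eta>, OF \<eta>]) blast
  define k where "k r = lift (\<kappa> r)" for r
  have CL: "u \<in> topspace L" if "u \<in> C" for u using that compactin_subset_topspace[OF C] by blast
  have cL [simp]: "c r \<in> topspace L" for r using CL c by blast
  have k_open: "openin L {u \<in> topspace L. k r u \<in> V}" if "open V" for r V
    unfolding k_def using cont that by (rule openin_lift)
  have k_supp: "finite {r. k r u \<noteq> 0}" if "u \<in> topspace L" for u
    using finite_lift_support[of UNIV \<kappa> u] cont pf that by (simp add: k_def)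
  have "infinite (UNIV :: nat set)" "c ` UNIV \<subseteq> C" using c by auto
  then obtain z where z: "z \<in> C" "\<And>U. openin L U \<Longrightarrow> z \<in> U \<Longrightarrow> infinite {r \<in> UNIV. c r \<in> U}"
    by (rule compactin_cluster_point[OF C]) blast
  have zL [simp]: "z \<in> topspace L" using CL z(1) .
  have freq: "\<exists>r>N. c r \<in> U" if "openin L U" "z \<in> U" for U N
    using z(2)[OF that] unfolding infinite_nat_iff_unbounded by simp
  \<comment> \<open>For fixed \<open>l\<close> the values \<open>k l (c r)\<close> tend to 0, and a
    cluster point inherits this limit.\<close>
  have kz: "k l z = 0" for l
  proof (rule ccontr)
    assume "k l z \<noteq> 0"
    then have pos: "0 < \<bar>k l z\<bar> / 2" by simp
    obtain R where R: "(1/2) ^ R < \<bar>k l z\<bar> / 2" using real_arch_pow_inv[OF pos, of "1/2"] by auto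
    have "openin L {u \<in> topspace L. k l u \<in> - cball 0 (\<bar>k l z\<bar> / 2)}" by (rule k_open) auto
    moreover have "z \<in> {u \<in> topspace L. k l u \<in> - cball 0 (\<bar>k l z\<bar> / 2)}" using pos by simp
    ultimately have "\<exists>r>max l R. c r \<in> {u \<in> topspace L. k l u \<in> - cball 0 (\<bar>k l z\<bar> / 2)}"
      by (rule freq)
    then obtain r where r: "max l R < r" "\<bar>k l z\<bar> / 2 < \<bar>k l (c r)\<bar>" by auto
    have "\<bar>k l (c r)\<bar> \<le> \<eta> r" unfolding k_def using r(1) by (intro lower) simp
    also have "\<dots> \<le> (1/2) ^ r / 4" by (rule \<eta>_le)
    also have "\<dots> \<le> (1/2) ^ r" by simp
    also have "\<dots> \<le> (1/2) ^ R" using r(1) by (intro power_decreasing) auto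
    finally show False using r(2) R by linarith
  qed
  define v where "v m = (\<Sum>j<m. (1/2::real) ^ j *\<^sub>R c j)" for m :: nat
  have vL [simp]: "v m \<in> topspace L" for m unfolding v_def by (intro mem_topspace) simp
  have kv: "k l (v m) = (\<Sum>j<m. (1/2) ^ j * k l (c j))" for l m
    unfolding k_def v_def by (simp add: lift_sum[OF cont] lift_scale[OF cont])
  have geometric: "(\<Sum>j<m. (1/2::real) ^ j) = 2 - 2 * (1/2) ^ m" for m
    by (induction m) auto
  \<comment> \<open>Terms with \<open>j < l\<close> vanish, the term \<open>j = l\<close> has
    absolute value at least \<open>(1/2) ^ l\<close>, and the later ones together amount to at most
    half of that.\<close>
  have kv_lower: "(1/2) ^ l / 2 \<le> \<bar>k l (v m)\<bar>" if l: "l < m" for l m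
  proof -
    let ?I = "{..<m} - {l}"
    have "\<bar>(1/2) ^ j * k l (c j)\<bar> \<le> (1/2) ^ l / 4 * (1/2) ^ j" if j: "j \<in> ?I" for j
    proof (cases "j < l")
      case True
      then show ?thesis using upper by (simp add: k_def)
    next
      case False
      then have lj: "l < j" using j by simp
      have "\<bar>k l (c j)\<bar> \<le> \<eta> j" unfolding k_def using lj by (rule lower)
      also have "\<dots> \<le> (1/2) ^ j / 4" by (rule \<eta>_le)
      also have "\<dots> \<le> (1/2) ^ l / 4" using lj by (intro divide_right_mono power_decreasing) auto
      finally have "(1/2) ^ j * \<bar>k l (c j)\<bar> \<le> (1/2) ^ j * ((1/2) ^ l / 4)"
        by (rule mult_left_mono) simp
      then show ?thesis by (simp add: abs_mult mult.commute)
    qed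
    then have "\<bar>\<Sum>j\<in>?I. (1/2) ^ j * k l (c j)\<bar> \<le> (\<Sum>j\<in>?I. (1/2) ^ l / 4 * (1/2) ^ j)"
      by (rule sum_abs[THEN order_trans, OF sum_mono])
    also have "\<dots> = (1/2) ^ l / 4 * (\<Sum>j\<in>?I. (1/2) ^ j)" by (simp only: sum_distrib_left)
    also have "\<dots> \<le> (1/2) ^ l / 4 * 2"
    proof (rule mult_left_mono)
      have "(\<Sum>j\<in>?I. (1/2::real) ^ j) \<le> (\<Sum>j<m. (1/2) ^ j)" by (rule sum_mono2) auto
      also have "\<dots> \<le> 2" unfolding geometric by simp
      finally show "(\<Sum>j\<in>?I. (1/2::real) ^ j) \<le> 2" .
    qed simp
    finally have rest: "\<bar>\<Sum>j\<in>?I. (1/2) ^ j * k l (c j)\<bar> \<le> (1/2) ^ l / 2" by simp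
    have "k l (v m) = (1/2) ^ l * k l (c l) + (\<Sum>j\<in>?I. (1/2) ^ j * k l (c j))"
      unfolding kv using l by (intro sum.remove) auto
    moreover have "(1/2) ^ l * 1 \<le> (1/2) ^ l * \<bar>k l (c l)\<bar>"
      unfolding k_def by (intro mult_left_mono diag) simp
    then have "(1/2) ^ l \<le> \<bar>(1/2) ^ l * k l (c l)\<bar>" by (simp add: abs_mult)
    ultimately show ?thesis using rest by linarith
  qed
  \<comment> \<open>The first summand is small for large \<open>n\<close>; for fixed
    \<open>n\<close> the second is small when \<open>c m\<close> is near \<open>z\<close>.
    Nevertheless \<open>k m\<close> has absolute value at least \<open>n\<close> on the sum.\<close>
  define a where "a n m = (1 / real n) *\<^sub>R v m + real n *\<^sub>R (c m - z)" for n m :: nat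
  have aL: "a n m \<in> topspace L" for n m by (simp add: a_def)
  have ka: "k l (a n m) = k l (v m) / real n + real n * k l (c m)" for l n m
    using kz[of l] unfolding a_def k_def by (simp add: lift_add[OF cont] lift_scale[OF cont] lift_diff[OF cont])
  \<comment> \<open>Half of lower bounds for \<open>\<bar>k l (a n m)\<bar>\<close>. For
    \<open>l < m\<close> the threshold does not involve \<open>m\<close>, so it survives a limit
    along row \<open>n\<close>.\<close>
  define \<tau> where "\<tau> n m l = (if l = m then real n / 2 else (1/2) ^ l / (8 * real n))" for n m l :: nat
  define U where "U n m = {u \<in> topspace L. \<forall>l\<in>{..m}. k l u \<in> - cball 0 (\<tau> n m l)}" for n m
  have UD: "\<tau> n m l < \<bar>k l u\<bar>" if u: "u \<in> U n m" and l: "l \<le> m" for n m l u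
  proof -
    have "\<forall>l\<in>{..m}. k l u \<in> - cball 0 (\<tau> n m l)" using u unfolding U_def by blast
    then have "k l u \<in> - cball 0 (\<tau> n m l)" by (rule bspec) (use l in simp)
    then show ?thesis by simp
  qed
  define J where "J = {p :: nat \<times> nat. 1 \<le> fst p \<and> fst p \<le> snd p}"
  have openU: "openin L (U n m)" for n m
    unfolding U_def by (intro openin_Collect_finite_ball k_open) auto
  have aU: "a n m \<in> U n m" if nm: "1 \<le> n" "n \<le> m" for n m
  proof -
    have "\<tau> n m l < \<bar>k l (a n m)\<bar>" if l: "l \<le> m" for l
    proof (cases "l = m")
      case True
      \<comment> \<open>Only \<open>c j\<close> with \<open>j < m\<close> enter \<open>v m\<close>,
        and \<open>k m\<close> annihilates all of them.\<close>
      have "k m (v m) = 0" unfolding kv using upper by (simp add: k_def)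
      then have "\<bar>k m (a n m)\<bar> = real n * \<bar>k m (c m)\<bar>" by (simp add: ka abs_mult)
      moreover have "real n * 1 \<le> real n * \<bar>k m (c m)\<bar>"
        unfolding k_def by (intro mult_left_mono diag) simp
      ultimately show ?thesis using nm by (simp add: \<tau>_def True)
    next
      case False
      then have lm: "l < m" using l by simp
      have n0: "0 < real n" using nm by simp
      have "real n * \<bar>k l (c m)\<bar> \<le> real n * \<eta> m"
        unfolding k_def using lm by (intro mult_left_mono lower) auto
      also have "\<dots> \<le> (1/2) ^ m / (4 * real n)" using nm by (rule \<eta>_le_n)
      also have "\<dots> \<le> (1/2) ^ l / (4 * real n)"
        using lm by (intro divide_right_mono power_decreasing) auto
      finally have 1: "\<bar>real n * k l (c m)\<bar> \<le> (1/2) ^ l / (4 * real n)" by (simp add: abs_mult)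
      have "(1/2) ^ l / 2 / real n \<le> \<bar>k l (v m)\<bar> / real n"
        using kv_lower[OF lm] by (intro divide_right_mono) auto
      then have 2: "2 * ((1/2) ^ l / (4 * real n)) \<le> \<bar>k l (v m) / real n\<bar>" by simp
      have "0 < (1/2) ^ l / (8 * real n)" using n0 by simp
      then have 3: "\<tau> n m l < (1/2) ^ l / (4 * real n)" using False by (simp add: \<tau>_def)
      show ?thesis unfolding ka using 1 2 3 by linarith
    qed
    then show ?thesis by (simp add: U_def aL not_le)
  qed
  have zeroU: "0 \<notin> U n m" for n m
    using lift_zero[OF cont] by (auto simp: U_def k_def \<tau>_def)
  have fin: "finite {p \<in> J. Q \<inter> U (fst p) (snd p) \<noteq> {}}" if Q: "compactin L Q" for Q
  proof -
    have QL: "u \<in> topspace L" if "u \<in> Q" for u using that compactin_subset_topspace[OF Q] by blast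
    obtain B where B: "\<And>q r. q \<in> Q \<Longrightarrow> r \<in> UNIV \<Longrightarrow> \<bar>k r q\<bar> \<le> B"
      unfolding k_def using cont bound Q
      by (rule lift_uniformly_bounded_on_compact[where J = UNIV and \<kappa> = \<kappa>]) blast+
    \<comment> \<open>Points of \<open>Q\<close> hitting infinitely many sets of row
      \<open>n\<close> have a cluster point in \<open>Q\<close> on which no \<open>k l\<close>
      vanishes, against finiteness of supports.\<close>
    have row: "finite {m. Q \<inter> U n m \<noteq> {}}" if n: "1 \<le> n" for n
    proof (rule ccontr)
      assume inf: "infinite {m. Q \<inter> U n m \<noteq> {}}"
      have "\<forall>m\<in>{m. Q \<inter> U n m \<noteq> {}}. \<exists>q. q \<in> Q \<and> q \<in> U n m" by blast
      from bchoice[OF this] obtain q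
        where q: "\<And>m. m \<in> {m. Q \<inter> U n m \<noteq> {}} \<Longrightarrow> q m \<in> Q"
          "\<And>m. m \<in> {m. Q \<inter> U n m \<noteq> {}} \<Longrightarrow> q m \<in> U n m" by blast
      have "q ` {m. Q \<inter> U n m \<noteq> {}} \<subseteq> Q" using q(1) by blast
      then obtain y where y: "y \<in> Q" "\<And>V. openin L V \<Longrightarrow> y \<in> V \<Longrightarrow>
          infinite {m \<in> {m. Q \<inter> U n m \<noteq> {}}. q m \<in> V}"
        by (rule compactin_cluster_point[OF Q inf]) blast
      have "k l y \<noteq> 0" for l
      proof
        assume "k l y = 0"
        let ?V = "{u \<in> topspace L. k l u \<in> ball 0 ((1/2) ^ l / (8 * real n))}"
        have "openin L ?V" by (rule k_open) simp
        moreover have "y \<in> ?V" using \<open>k l y = 0\<close> QL[OF y(1)] n by simp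
        ultimately have "infinite {m \<in> {m. Q \<inter> U n m \<noteq> {}}. q m \<in> ?V}" by (rule y(2))
        then obtain m where m: "l < m" "m \<in> {m \<in> {m. Q \<inter> U n m \<noteq> {}}. q m \<in> ?V}"
          unfolding infinite_nat_iff_unbounded by blast
        then have "q m \<in> U n m" using q(2) by blast
        then have "\<tau> n m l < \<bar>k l (q m)\<bar>" by (rule UD) (use m(1) in simp)
        moreover have "\<bar>k l (q m)\<bar> < (1/2) ^ l / (8 * real n)" using m(2) by simp
        ultimately show False using m(1) by (simp add: \<tau>_def)
      qed
      then have "{r. k r y \<noteq> 0} = UNIV" by blast
      then show False using k_supp[OF QL[OF y(1)]] by simp
    qed
    show ?thesis
    proof (rule finite_subset)
      \<comment> \<open>On \<open>U n m\<close> the functional \<open>k m\<close> exceeds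
        \<open>n / 2\<close> in absolute value, while \<open>B\<close> bounds it on
        \<open>Q\<close>; so only rows with \<open>n < 2 * B\<close> are met.\<close>
      show "finite (SIGMA n:{1..nat \<lceil>2 * B\<rceil>}. {m. Q \<inter> U n m \<noteq> {}})"
        using row by (intro finite_SigmaI) auto
      show "{p \<in> J. Q \<inter> U (fst p) (snd p) \<noteq> {}} \<subseteq> (SIGMA n:{1..nat \<lceil>2 * B\<rceil>}. {m. Q \<inter> U n m \<noteq> {}})"
      proof (rule subsetI)
        fix p assume p: "p \<in> {p \<in> J. Q \<inter> U (fst p) (snd p) \<noteq> {}}"
        obtain n m where nm: "p = (n, m)" by (cases p)
        obtain q where q: "q \<in> Q" "q \<in> U n m" using p nm by auto
        have "\<tau> n m m < \<bar>k m q\<bar>" using q(2) by (rule UD) simp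
        then have "real n / 2 < B" using B[OF q(1), of m] by (simp add: \<tau>_def)
        then have "n \<le> nat \<lceil>2 * B\<rceil>" by linarith
        then show "p \<in> (SIGMA n:{1..nat \<lceil>2 * B\<rceil>}. {m. Q \<inter> U n m \<noteq> {}})"
          using p nm by (auto simp: J_def)
      qed
    qed
  qed
  obtain W where W: "openin L W" "0 \<in> W" "\<And>p. p \<in> J \<Longrightarrow> a (fst p) (snd p) \<notin> W"
  proof (rule ascoli_space_no_strict_fan[OF L, of J "\<lambda>p. U (fst p) (snd p)" "\<lambda>p. a (fst p) (snd p)" 0])
    show "openin L (U (fst p) (snd p))" for p by (rule openU)
    show "a (fst p) (snd p) \<in> U (fst p) (snd p)" if "p \<in> J" for p
      using that by (intro aU) (auto simp: J_def)
    show "0 \<notin> U (fst p) (snd p)" for p by (rule zeroU)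
  qed (use fin in auto)
  obtain A D where AD: "openin L A" "convex D" "0 \<in> A" "A \<subseteq> D" "D \<subseteq> W"
    using W(1,2) by (rule convex_neighbourhood)
  obtain \<delta> where \<delta>: "\<delta> > 0" "\<And>t u. \<bar>t\<bar> < \<delta> \<Longrightarrow> u \<in> C \<Longrightarrow> t *\<^sub>R u \<in> A"
    using C AD(1,3) by (rule compactin_absorbed) blast
  \<comment> \<open>First \<open>n\<close> is fixed so that \<open>4 / n\<close> times each
    \<open>c j\<close> lies in \<open>A\<close>; only then is \<open>m > n\<close> found with
    \<open>2 * n\<close> times \<open>c m - z\<close> in \<open>A\<close>.\<close>
  obtain n0 :: nat where n0: "4 / \<delta> < real n0" using reals_Archimedean2 by blast
  define n where "n = Suc n0"
  have n: "1 \<le> n" "4 / real n < \<delta>"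
  proof -
    have "4 / \<delta> < real n" using n0 by (simp add: n_def)
    then show "4 / real n < \<delta>" using \<delta>(1) by (simp add: n_def field_simps)
  qed (simp add: n_def)
  let ?O = "{u \<in> topspace L. (2 * real n) *\<^sub>R (u - z) \<in> A}"
  have "continuous_map L L (\<lambda>u. (2 * real n) *\<^sub>R (u - z))"
    by (intro continuous_map_scaleR continuous_map_vector_diff) auto
  then have "openin L ?O" using AD(1) by (rule openin_continuous_map_preimage)
  moreover have "z \<in> ?O" using AD(3) by simp
  ultimately have "\<exists>r>n. c r \<in> ?O" by (rule freq)
  then obtain m where m: "n < m" "(2 * real n) *\<^sub>R (c m - z) \<in> A" by blast
  \<comment> \<open>The weights sum to less than 1, so \<open>2 / n\<close> times \<open>v m\<close>
    lies in \<open>D\<close> whatever \<open>m\<close> is; \<open>a n m\<close> is the midpoint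
    between it and \<open>2 * n\<close> times \<open>c m - z\<close>.\<close>
  have "(\<Sum>j<m. ((1/2) ^ j / 2) *\<^sub>R ((4 / real n) *\<^sub>R c j)) \<in> D"
  proof (rule convex_subunit_sum)
    show "(\<Sum>j<m. (1/2::real) ^ j / 2) \<le> 1"
      unfolding sum_divide_distrib[symmetric] geometric by simp
    show "(4 / real n) *\<^sub>R c j \<in> D" for j using \<delta>(2)[OF _ c] n AD(4) by auto
  qed (use AD in auto)
  moreover have "(\<Sum>j<m. ((1/2) ^ j / 2) *\<^sub>R ((4 / real n) *\<^sub>R c j)) = (2 / real n) *\<^sub>R v m"
    unfolding v_def scaleR_sum_right scaleR_scaleR by (intro sum.cong refl arg_cong2[where f = scaleR]) simp
  ultimately have "(1/2) *\<^sub>R ((2 / real n) *\<^sub>R v m) + (1/2) *\<^sub>R ((2 * real n) *\<^sub>R (c m - z)) \<in> D"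
    using m(2) AD(2,4) by (intro convexD) auto
  then have "a n m \<in> D" by (simp add: a_def)
  moreover have "(n, m) \<in> J" using n m by (simp add: J_def)
  ultimately show False using W(3)[of "(n, m)"] AD(5) by auto
qed

end

section \<open>Countable discrete spaces\<close>

context lcs
begin

text \<open>For a single \<open>f\<close> the tube lemma gives a width, and a strict bound on a
  compact tube persists for all functions near \<open>f\<close> in the compact-open topology.
  Finitely many such neighbourhoods cover \<open>K\<close>; take the least width.\<close>

lemma compact_family_tube:
  assumes K: "compactin (compact_open_topology L) K" and B: "compactin L B"
    and e: "e \<in> topspace L" and y: "y \<in> topspace L" and \<epsilon>: "0 < \<epsilon>"
    and close: "\<And>f b. f \<in> K \<Longrightarrow> b \<in> B \<Longrightarrow> \<bar>f b - f y\<bar> < \<epsilon>"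
  obtains \<delta> where "\<delta> > 0"
    "\<And>f b t. f \<in> K \<Longrightarrow> b \<in> B \<Longrightarrow> \<bar>t\<bar> \<le> \<delta> \<Longrightarrow> \<bar>f (b + t *\<^sub>R e) - f y\<bar> < \<epsilon>"
proof -
  let ?T = "compact_open_topology L"
  define good where "good N \<delta> \<longleftrightarrow> 0 < \<delta> \<and>
      (\<forall>h\<in>N. \<forall>b\<in>B. \<forall>t. \<bar>t\<bar> \<le> \<delta> \<longrightarrow> \<bar>h (b + t *\<^sub>R e) - h y\<bar> < \<epsilon>)"
    for N :: "('v \<Rightarrow> real) set" and \<delta> :: real
  have basic: "openin ?T {f \<in> extensional (topspace L). continuous_map L euclideanreal f \<and> f ` C \<subseteq> V}"
    if "compactin L C" "open V" for C V
    unfolding compact_open_topology_def using that by (intro topology_generated_by_Basis) blast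
  have local: "\<exists>N. openin ?T N \<and> f \<in> N \<and> (\<exists>\<delta>. good N \<delta>)" if f: "f \<in> K" for f
  proof -
    have fT: "f \<in> extensional (topspace L)" "continuous_map L euclideanreal f"
      using f compactin_subset_topspace[OF K] by (auto simp: topspace_compact_open_topology)
    let ?A = "{u \<in> topspace L. f u \<in> ball (f y) \<epsilon>}"
    have A: "openin L ?A" using fT(2) by (rule openin_continuous_map_preimage) simp
    have "B \<subseteq> ?A"
      using close[OF f] compactin_subset_topspace[OF B] by (auto simp: dist_real_def abs_minus_commute)
    then obtain \<delta> where \<delta>: "\<delta> > 0" "\<And>t b. \<bar>t\<bar> < \<delta> \<Longrightarrow> b \<in> B \<Longrightarrow> b + t *\<^sub>R e \<in> ?A"
      by (rule compactin_tube[OF B e A]) blast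
    \<comment> \<open>The tube bound holds for \<open>\<bar>t\<bar> < \<delta>\<close> only; halving
      leaves room for a closed, hence compact, interval.\<close>
    define C where "C = (\<lambda>p. fst p + snd p *\<^sub>R e) ` (B \<times> {- (\<delta>/2)..\<delta>/2})"
    have C: "compactin L C"
      unfolding C_def
    proof (rule image_compactin)
      show "compactin (prod_topology L euclideanreal) (B \<times> {- (\<delta>/2)..\<delta>/2})"
        using B by (simp add: compactin_Times)
      show "continuous_map (prod_topology L euclideanreal) L (\<lambda>p. fst p + snd p *\<^sub>R e)"
        using e by (intro continuous_map_vector_add continuous_map_scaleR continuous_map_fst
            continuous_map_snd) auto
    qed
    have CA: "C \<subseteq> ?A" unfolding C_def using \<delta> by auto
    have "continuous_map L euclideanreal (\<lambda>u. \<bar>f u - f y\<bar>)"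
      using fT(2) by (intro continuous_intros) auto
    from image_compactin[OF C this] have cpt: "compact ((\<lambda>u. \<bar>f u - f y\<bar>) ` C)" by simp
    obtain \<rho> where \<rho>: "\<rho> < \<epsilon>" "\<And>u. u \<in> C \<Longrightarrow> \<bar>f u - f y\<bar> \<le> \<rho>"
    proof (cases "C = {}")
      case True
      then show ?thesis using that[of 0] \<epsilon> by blast
    next
      case False
      then obtain u where u: "u \<in> C" "\<And>w. w \<in> C \<Longrightarrow> \<bar>f w - f y\<bar> \<le> \<bar>f u - f y\<bar>"
        using compact_attains_sup[OF cpt] by auto
      have "\<bar>f u - f y\<bar> < \<epsilon>" using CA u(1) by (auto simp: dist_real_def abs_minus_commute)
      then show ?thesis using that u(2) by blast
    qed
    \<comment> \<open>The slack \<open>\<epsilon> - \<rho>\<close> is split evenly between the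
      values on \<open>C\<close> and the value at \<open>y\<close>, so the two radii add up to
      \<open>\<epsilon>\<close>.\<close>
    define N where "N =
      {h \<in> extensional (topspace L). continuous_map L euclideanreal h \<and> h ` C \<subseteq> ball (f y) ((\<epsilon> + \<rho>) / 2)} \<inter>
      {h \<in> extensional (topspace L). continuous_map L euclideanreal h \<and> h ` {y} \<subseteq> ball (f y) ((\<epsilon> - \<rho>) / 2)}"
    have "openin ?T N" unfolding N_def using C y by (intro openin_Int basic) auto
    moreover have "f \<in> N"
    proof -
      have "f u \<in> ball (f y) ((\<epsilon> + \<rho>) / 2)" if "u \<in> C" for u
        using \<rho>(2)[OF that] \<rho>(1) by (simp add: dist_real_def abs_minus_commute)
      moreover have "f y \<in> ball (f y) ((\<epsilon> - \<rho>) / 2)" using \<rho>(1) by simp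
      ultimately show ?thesis using fT unfolding N_def by blast
    qed
    moreover have "good N (\<delta>/2)"
      unfolding good_def
    proof (intro conjI ballI allI impI)
      show "0 < \<delta> / 2" using \<delta>(1) by simp
      fix h b and t :: real assume h: "h \<in> N" and b: "b \<in> B" and t: "\<bar>t\<bar> \<le> \<delta> / 2"
      have "(b, t) \<in> B \<times> {- (\<delta>/2)..\<delta>/2}" using b t by auto
      then have "b + t *\<^sub>R e \<in> C" unfolding C_def by (rule rev_image_eqI) simp
      then have "h (b + t *\<^sub>R e) \<in> ball (f y) ((\<epsilon> + \<rho>) / 2)" "h y \<in> ball (f y) ((\<epsilon> - \<rho>) / 2)"
        using h unfolding N_def by blast+
      then have "\<bar>f y - h (b + t *\<^sub>R e)\<bar> < (\<epsilon> + \<rho>) / 2" "\<bar>f y - h y\<bar> < (\<epsilon> - \<rho>) / 2"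
        by (simp_all add: dist_real_def)
      then show "\<bar>h (b + t *\<^sub>R e) - h y\<bar> < \<epsilon>" by argo
    qed
    ultimately show ?thesis by blast
  qed
  define \<U> where "\<U> = {N. openin ?T N \<and> (\<exists>\<delta>. good N \<delta>)}"
  have "\<exists>\<F>. finite \<F> \<and> \<F> \<subseteq> \<U> \<and> K \<subseteq> \<Union>\<F>"
  proof (rule compactinD[OF K])
    show "openin ?T N" if "N \<in> \<U>" for N using that by (simp add: \<U>_def)
    show "K \<subseteq> \<Union>\<U>"
    proof
      fix f assume "f \<in> K"
      from local[OF this] show "f \<in> \<Union>\<U>" unfolding \<U>_def by blast
    qed
  qed
  then obtain \<F> where \<F>: "finite \<F>" "\<F> \<subseteq> \<U>" "K \<subseteq> \<Union>\<F>" by auto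
  have "\<forall>N\<in>\<F>. \<exists>\<delta>. good N \<delta>" using \<F>(2) unfolding \<U>_def by blast
  from bchoice[OF this] obtain \<delta> where \<delta>: "\<forall>N\<in>\<F>. good N (\<delta> N)" by blast
  show ?thesis
  \<comment> \<open>The 1 covers the case of an empty subcover.\<close>
  proof (rule that[of "Min (insert 1 (\<delta> ` \<F>))"])
    show "0 < Min (insert 1 (\<delta> ` \<F>))" using \<F>(1) \<delta> by (simp add: good_def)
    fix f b and t :: real assume f: "f \<in> K" and b: "b \<in> B" and t: "\<bar>t\<bar> \<le> Min (insert 1 (\<delta> ` \<F>))"
    obtain N where N: "N \<in> \<F>" "f \<in> N" using f \<F>(3) by blast
    have "\<bar>t\<bar> \<le> \<delta> N" using t N(1) \<F>(1) by simp
    then show "\<bar>f (b + t *\<^sub>R e) - f y\<bar> < \<epsilon>" using \<delta> N b unfolding good_def by blast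
  qed
qed

text \<open>
  The hypotheses say that \<open>L\<close> has a countable basis \<open>e\<close> with coordinates \<open>\<tau>\<close> and carries the
  finest locally convex topology.
\<close>

lemma ascoli_of_countable_basis:
  fixes e :: "nat \<Rightarrow> 'v" and \<tau> :: "nat \<Rightarrow> 'v \<Rightarrow> real"
  assumes e: "\<And>n. e n \<in> topspace L"
    and expand: "\<And>u. u \<in> topspace L \<Longrightarrow> \<exists>N. u = (\<Sum>n<N. \<tau> n u *\<^sub>R e n)"
    and box: "\<And>\<delta>::nat \<Rightarrow> real. (\<And>n. 0 < \<delta> n) \<Longrightarrow> \<exists>P. continuous_map L euclideanreal P \<and> P 0 = 0 \<and>
        (\<forall>u\<in>topspace L. \<forall>n. \<bar>\<tau> n u\<bar> \<le> \<delta> n * P u)"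
  shows "ascoli_space L"
proof -
  have shift: "continuous_map L euclideanreal (\<lambda>u. P (u - y))"
    if "continuous_map L euclideanreal P" "y \<in> topspace L" for P :: "'v \<Rightarrow> real" and y
  proof -
    have "continuous_map L L (\<lambda>u. u - y)" using that(2) by (intro continuous_map_vector_diff) auto
    from continuous_map_compose[OF this that(1)] show ?thesis by (simp add: comp_def)
  qed
  \<comment> \<open>A convex neighbourhood absorbs each \<open>e n\<close>; with summable weights
    \<open>w n\<close> it contains a box, and \<open>box\<close> gives a continuous \<open>P\<close>
    with \<open>P < 1\<close> inside that box.\<close>
  have "completely_regular_space L"
    unfolding completely_regular_space_alt'
  proof (intro allI impI)
    fix S y assume S: "openin L S" and yS: "y \<in> S"
    have y: "y \<in> topspace L" using S yS openin_subset by blast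
    let ?W = "{u \<in> topspace L. y + u \<in> S}"
    have "continuous_map L L (\<lambda>u. y + u)" using y by (intro continuous_map_vector_add) auto
    then have "openin L ?W" using S by (rule openin_continuous_map_preimage)
    moreover have "0 \<in> ?W" using yS by simp
    ultimately obtain A D where AD: "openin L A" "convex D" "0 \<in> A" "A \<subseteq> D" "D \<subseteq> ?W"
      by (rule convex_neighbourhood)
    have "\<forall>n. \<exists>\<delta>. 0 < \<delta> \<and> (\<forall>t. \<bar>t\<bar> < \<delta> \<longrightarrow> t *\<^sub>R e n \<in> A)"
    proof
      fix n
      have "compactin L {e n}" using e by simp
      then obtain \<delta> where "\<delta> > 0" "\<And>t c. \<bar>t\<bar> < \<delta> \<Longrightarrow> c \<in> {e n} \<Longrightarrow> t *\<^sub>R c \<in> A"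
        using AD(1,3) by (rule compactin_absorbed) blast
      then show "\<exists>\<delta>. 0 < \<delta> \<and> (\<forall>t. \<bar>t\<bar> < \<delta> \<longrightarrow> t *\<^sub>R e n \<in> A)" by blast
    qed
    from choice[OF this] obtain \<delta>
      where \<delta>: "\<And>n. 0 < \<delta> n" "\<And>n t. \<bar>t\<bar> < \<delta> n \<Longrightarrow> t *\<^sub>R e n \<in> A" by blast
    define w :: "nat \<Rightarrow> real" where "w n = (1/2) ^ Suc n" for n
    have w: "0 < w n" for n by (simp add: w_def)
    have w_sum: "(\<Sum>n<N. w n) \<le> 1" for N
    proof -
      have "(\<Sum>n<N. w n) = 1 - (1/2) ^ N" by (induction N) (auto simp: w_def)
      then show ?thesis by simp
    qed
    have "0 < \<delta> n * w n" for n using \<delta>(1) w by simp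
    then have "\<exists>P. continuous_map L euclideanreal P \<and> P 0 = 0 \<and>
        (\<forall>u\<in>topspace L. \<forall>n. \<bar>\<tau> n u\<bar> \<le> \<delta> n * w n * P u)"
      by (rule box)
    then obtain P where P: "continuous_map L euclideanreal P" "P 0 = 0"
      "\<forall>u\<in>topspace L. \<forall>n. \<bar>\<tau> n u\<bar> \<le> \<delta> n * w n * P u"
      by (elim exE conjE) (rule that)
    have inS: "u \<in> S" if u: "u \<in> topspace L" and small: "P (u - y) < 1" for u
    proof -
      let ?u = "u - y"
      have uL: "?u \<in> topspace L" using u y by simp
      obtain N where N: "?u = (\<Sum>n<N. \<tau> n ?u *\<^sub>R e n)" using expand[OF uL] by blast
      have "(\<Sum>n<N. w n *\<^sub>R ((\<tau> n ?u / w n) *\<^sub>R e n)) \<in> D"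
      proof (rule convex_subunit_sum)
        fix n
        have "\<bar>\<tau> n ?u\<bar> \<le> \<delta> n * w n * P ?u" using bspec[OF P(3) uL] ..
        also have "\<dots> < \<delta> n * w n * 1" using small \<delta>(1) w by (intro mult_strict_left_mono) auto
        finally have "\<bar>\<tau> n ?u / w n\<bar> < \<delta> n" using w[of n] by (simp add: abs_divide pos_divide_less_eq)
        then show "(\<tau> n ?u / w n) *\<^sub>R e n \<in> D" using \<delta>(2) AD(4) by blast
      qed (use AD w[THEN less_imp_le] w_sum in auto)
      moreover have "(\<Sum>n<N. w n *\<^sub>R ((\<tau> n ?u / w n) *\<^sub>R e n)) = (\<Sum>n<N. \<tau> n ?u *\<^sub>R e n)"
      proof (rule sum.cong[OF refl])
        fix n show "w n *\<^sub>R ((\<tau> n ?u / w n) *\<^sub>R e n) = \<tau> n ?u *\<^sub>R e n" using w[of n] by simp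
      qed
      ultimately have "(\<Sum>n<N. \<tau> n ?u *\<^sub>R e n) \<in> D" by simp
      then have "?u \<in> D" unfolding N[symmetric] .
      then show ?thesis using AD(5) by auto
    qed
    show "\<exists>f. continuous_map L euclideanreal f \<and> f y = 0 \<and> f ` (topspace L - S) \<subseteq> {1}"
    proof (intro exI conjI)
      show "continuous_map L euclideanreal (\<lambda>u. min 1 (P (u - y)))"
        using shift[OF P(1) y] by (intro continuous_intros) auto
      show "min 1 (P (y - y)) = 0" using P(2) by simp
      show "(\<lambda>u. min 1 (P (u - y))) ` (topspace L - S) \<subseteq> {1}"
        using inS by (force simp: min_def)
    qed
  qed
  moreover have "equicontinuous_family L K" if K: "compactin (compact_open_topology L) K" for K
    unfolding equicontinuous_family_def
  proof (intro ballI allI impI)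
    fix y and \<epsilon> :: real assume y: "y \<in> topspace L" and \<epsilon>: "0 < \<epsilon>"
    \<comment> \<open>On each \<open>B n\<close> all of \<open>K\<close> stays within
      \<open>\<epsilon>\<close> of its value at \<open>y\<close>; the next set contains
      \<open>B n\<close> thickened in direction \<open>e n\<close>.\<close>
    define R where "R n B \<longleftrightarrow> compactin L B \<and> (\<forall>f\<in>K. \<forall>b\<in>B. \<bar>f b - f y\<bar> < \<epsilon>) \<and> (n = 0 \<longrightarrow> y \<in> B)"
      for n :: nat and B
    have "\<exists>B. \<forall>n. R n (B n) \<and> (\<exists>\<delta>>0. \<forall>b\<in>B n. \<forall>t. \<bar>t\<bar> \<le> \<delta> \<longrightarrow> b + t *\<^sub>R e n \<in> B (Suc n))"
    proof (rule dependent_nat_choice)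
      show "\<exists>B. R 0 B" using y \<epsilon> by (intro exI[of _ "{y}"]) (simp add: R_def)
      fix B n assume "R n B"
      then have B: "compactin L B" "\<And>f b. f \<in> K \<Longrightarrow> b \<in> B \<Longrightarrow> \<bar>f b - f y\<bar> < \<epsilon>"
        by (auto simp: R_def)
      obtain \<delta> where \<delta>: "\<delta> > 0"
        "\<And>f b t. f \<in> K \<Longrightarrow> b \<in> B \<Longrightarrow> \<bar>t\<bar> \<le> \<delta> \<Longrightarrow> \<bar>f (b + t *\<^sub>R e n) - f y\<bar> < \<epsilon>"
        by (rule compact_family_tube[OF K B(1) e y \<epsilon> B(2)]) blast+
      let ?B = "(\<lambda>p. fst p + snd p *\<^sub>R e n) ` (B \<times> {-\<delta>..\<delta>})"
      have "compactin L ?B"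
      proof (rule image_compactin)
        show "compactin (prod_topology L euclideanreal) (B \<times> {-\<delta>..\<delta>})"
          using B(1) by (simp add: compactin_Times)
        show "continuous_map (prod_topology L euclideanreal) L (\<lambda>p. fst p + snd p *\<^sub>R e n)"
          using e by (intro continuous_map_vector_add continuous_map_scaleR continuous_map_fst
              continuous_map_snd) auto
      qed
      then have "R (Suc n) ?B" using \<delta>(2) by (auto simp: R_def)
      moreover have "b + t *\<^sub>R e n \<in> ?B" if "b \<in> B" "\<bar>t\<bar> \<le> \<delta>" for b t
      proof -
        have "(b, t) \<in> B \<times> {-\<delta>..\<delta>}" using that by auto
        then show ?thesis by (rule rev_image_eqI) simp
      qed
      ultimately show "\<exists>B'. R (Suc n) B' \<and> (\<exists>\<delta>>0. \<forall>b\<in>B. \<forall>t. \<bar>t\<bar> \<le> \<delta> \<longrightarrow> b + t *\<^sub>R e n \<in> B')"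
        using \<delta>(1) by blast
    qed
    then obtain B where R: "\<And>n. R n (B n)"
      and "\<forall>n. \<exists>\<delta>>0. \<forall>b\<in>B n. \<forall>t. \<bar>t\<bar> \<le> \<delta> \<longrightarrow> b + t *\<^sub>R e n \<in> B (Suc n)" by blast
    from choice[OF this(2)] obtain \<delta> where \<delta>: "\<And>n. 0 < \<delta> n"
      "\<And>n b t. b \<in> B n \<Longrightarrow> \<bar>t\<bar> \<le> \<delta> n \<Longrightarrow> b + t *\<^sub>R e n \<in> B (Suc n)" by blast
    have mem: "y + (\<Sum>n<N. t n *\<^sub>R e n) \<in> B N" if t: "\<And>n. \<bar>t n\<bar> \<le> \<delta> n" for t :: "nat \<Rightarrow> real" and N
    proof (induction N)
      case 0
      show ?case using R[of 0] by (simp add: R_def)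
    next
      case (Suc N)
      from \<delta>(2)[OF Suc t] show ?case by (simp add: add.assoc)
    qed
    have "\<exists>P. continuous_map L euclideanreal P \<and> P 0 = 0 \<and>
        (\<forall>u\<in>topspace L. \<forall>n. \<bar>\<tau> n u\<bar> \<le> \<delta> n * P u)"
      using \<delta>(1) by (rule box)
    then obtain P where P: "continuous_map L euclideanreal P" "P 0 = 0"
      "\<forall>u\<in>topspace L. \<forall>n. \<bar>\<tau> n u\<bar> \<le> \<delta> n * P u"
      by (elim exE conjE) (rule that)
    \<comment> \<open>Here every coordinate of \<open>u - y\<close> is at most
      \<open>\<delta> n\<close>; since the expansion is finite, \<open>u\<close> lies in some
      \<open>B N\<close>, with \<open>N\<close> depending on \<open>u\<close>.\<close>
    let ?U = "{u \<in> topspace L. P (u - y) \<in> {..<1}}"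
    show "\<exists>U. openin L U \<and> y \<in> U \<and> (\<forall>u\<in>U. \<forall>f\<in>K. \<bar>f u - f y\<bar> < \<epsilon>)"
    proof (intro exI conjI ballI)
      show "openin L ?U" using shift[OF P(1) y] by (rule openin_continuous_map_preimage) simp
      show "y \<in> ?U" using y P(2) by simp
      fix u f assume u: "u \<in> ?U" and f: "f \<in> K"
      let ?u = "u - y"
      have uL: "?u \<in> topspace L" using u y by simp
      obtain N where N: "?u = (\<Sum>n<N. \<tau> n ?u *\<^sub>R e n)" using expand[OF uL] by blast
      have "\<bar>\<tau> n ?u\<bar> \<le> \<delta> n" for n
      proof -
        have "\<bar>\<tau> n ?u\<bar> \<le> \<delta> n * P ?u" using bspec[OF P(3) uL] ..
        also have "\<dots> \<le> \<delta> n * 1" using u \<delta>(1)[of n] by (intro mult_left_mono) auto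
        finally show ?thesis by simp
      qed
      then have "y + (\<Sum>n<N. \<tau> n ?u *\<^sub>R e n) \<in> B N" by (rule mem)
      then have "u \<in> B N" unfolding N[symmetric] by simp
      then show "\<bar>f u - f y\<bar> < \<epsilon>" using R[of N] f by (simp add: R_def)
    qed
  qed
  ultimately show ?thesis
    using locally_convex by (simp add: ascoli_space_def tychonoff_space_def locally_convex_space_def)
qed

end

context free_lcs
begin

text \<open>On a discrete space the coordinates divided by arbitrary \<open>\<delta> n > 0\<close>
  still form a continuous map into the bounded sequences, so \<open>lift_dominated\<close> supplies
  the function \<open>P\<close> for every box.\<close>

lemma countable_discrete_imp_ascoli:
  assumes X: "X = discrete_topology (topspace X)" and countable: "countable (topspace X)"
  shows "ascoli_space L"
proof -
  define idx where "idx = to_nat_on (topspace X)"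
  have inj: "inj_on idx (topspace X)" using countable unfolding idx_def by (rule inj_on_to_nat_on)
  have cont: "continuous_map X euclideanreal f" for f :: "'a \<Rightarrow> real" by (subst X) simp
  define \<xi> :: "nat \<Rightarrow> 'a \<Rightarrow> real" where "\<xi> n x = (if idx x = n then 1 else 0)" for n x
  define \<tau> where "\<tau> n = lift (\<xi> n)" for n
  define e where "e n = (if n \<in> idx ` topspace X then i (inv_into (topspace X) idx n) else 0)" for n
  have e_idx: "e (idx x) = i x" if "x \<in> topspace X" for x
    using that inj by (simp add: e_def)
  have \<tau>_i: "\<tau> n (i x) = (if idx x = n then 1 else 0)" if "x \<in> topspace X" for n x
    using lift_i[OF cont that] by (simp add: \<tau>_def \<xi>_def)
  show ?thesis
  proof (rule ascoli_of_countable_basis)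
    show "e n \<in> topspace L" for n by (auto simp: e_def inv_into_into)
    \<comment> \<open>Requiring the expansion for all large \<open>N\<close> gives two vectors a
      common length, so that the set is closed under addition.\<close>
    let ?S = "{u \<in> topspace L. \<exists>M. \<forall>N\<ge>M. u = (\<Sum>n<N. \<tau> n u *\<^sub>R e n)}"
    have "subspace ?S"
    proof (rule subspaceI)
      have "\<tau> n 0 = 0" for n unfolding \<tau>_def using cont by (rule lift_zero)
      then show "0 \<in> ?S" by simp
      show "u + v \<in> ?S" if uv: "u \<in> ?S" "v \<in> ?S" for u v
      proof -
        obtain M M' where M: "\<And>N. M \<le> N \<Longrightarrow> u = (\<Sum>n<N. \<tau> n u *\<^sub>R e n)"
          "\<And>N. M' \<le> N \<Longrightarrow> v = (\<Sum>n<N. \<tau> n v *\<^sub>R e n)" using uv by blast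
        have "\<tau> n (u + v) = \<tau> n u + \<tau> n v" for n
          unfolding \<tau>_def using uv by (intro lift_add cont) auto
        then have "u + v = (\<Sum>n<N. \<tau> n (u + v) *\<^sub>R e n)" if "max M M' \<le> N" for N
          using M(1)[of N] M(2)[of N] that by (simp add: scaleR_add_left sum.distrib)
        then have "\<exists>M. \<forall>N\<ge>M. u + v = (\<Sum>n<N. \<tau> n (u + v) *\<^sub>R e n)" by blast
        moreover have "u + v \<in> topspace L" using uv by auto
        ultimately show ?thesis by blast
      qed
      show "a *\<^sub>R u \<in> ?S" if u: "u \<in> ?S" for a u
      proof -
        obtain M where M: "\<And>N. M \<le> N \<Longrightarrow> u = (\<Sum>n<N. \<tau> n u *\<^sub>R e n)" using u by blast
        have "\<tau> n (a *\<^sub>R u) = a * \<tau> n u" for n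
          unfolding \<tau>_def using u by (intro lift_scale cont) auto
        then have "(\<Sum>n<N. \<tau> n (a *\<^sub>R u) *\<^sub>R e n) = a *\<^sub>R (\<Sum>n<N. \<tau> n u *\<^sub>R e n)" for N
          by (simp add: scaleR_sum_right)
        then have "a *\<^sub>R u = (\<Sum>n<N. \<tau> n (a *\<^sub>R u) *\<^sub>R e n)" if "M \<le> N" for N
          using M[OF that] by simp
        then have "\<exists>M. \<forall>N\<ge>M. a *\<^sub>R u = (\<Sum>n<N. \<tau> n (a *\<^sub>R u) *\<^sub>R e n)" by blast
        moreover have "a *\<^sub>R u \<in> topspace L" using u by auto
        ultimately show ?thesis by blast
      qed
    qed
    moreover have "i x \<in> ?S" if x: "x \<in> topspace X" for x
    proof -
      have "i x = (\<Sum>n<N. \<tau> n (i x) *\<^sub>R e n)" if "Suc (idx x) \<le> N" for N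
      proof -
        have "(\<Sum>n<N. \<tau> n (i x) *\<^sub>R e n) = (\<Sum>n<N. if n = idx x then e n else 0)"
          by (intro sum.cong) (auto simp: \<tau>_i[OF x])
        also have "\<dots> = e (idx x)" using that by simp
        finally show ?thesis using e_idx[OF x] by simp
      qed
      then have "\<exists>M. \<forall>N\<ge>M. i x = (\<Sum>n<N. \<tau> n (i x) *\<^sub>R e n)" by blast
      then show ?thesis using i_mem[OF x] by blast
    qed
    ultimately have "topspace L \<subseteq> ?S" by (rule topspace_subset_subspace)
    then show "\<exists>N. u = (\<Sum>n<N. \<tau> n u *\<^sub>R e n)" if "u \<in> topspace L" for u
      using that by blast
    show "\<exists>P. continuous_map L euclideanreal P \<and> P 0 = 0 \<and>
        (\<forall>u\<in>topspace L. \<forall>n. \<bar>\<tau> n u\<bar> \<le> \<delta> n * P u)" if \<delta>: "\<And>n. 0 < \<delta> n" for \<delta> :: "nat \<Rightarrow> real"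
    proof -
      have pf: "finite {n. (1 / \<delta> n) * \<xi> n x \<noteq> 0}" for x
        by (rule finite_subset[of _ "{idx x}"]) (auto simp: \<xi>_def)
      obtain f :: "'a \<Rightarrow> nat \<Rightarrow>\<^sub>C real"
        where f: "\<And>x n. x \<in> UNIV \<Longrightarrow> apply_bcontfun (f x) n = (1 / \<delta> n) * \<xi> n x"
        by (rule bcontfun_of_point_finite[where S = UNIV and \<kappa> = "\<lambda>n x. (1 / \<delta> n) * \<xi> n x", OF pf]) blast+
      have "continuous_map X euclidean f" by (subst X) simp
      then obtain P where P: "continuous_map L euclideanreal P" "P 0 = 0"
        "\<And>u n. u \<in> topspace L \<Longrightarrow> \<bar>lift (\<lambda>x. apply_bcontfun (f x) n) u\<bar> \<le> P u"
        by (rule lift_dominated) blast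
      have "\<bar>\<tau> n u\<bar> \<le> \<delta> n * P u" if u: "u \<in> topspace L" for u n
      proof -
        have "\<bar>(1 / \<delta> n) * \<tau> n u\<bar> \<le> P u"
          using P(3)[OF u, of n] by (simp only: f UNIV_I lift_cmult[OF cont u] \<tau>_def)
        then show ?thesis using \<delta>[of n] by (simp add: abs_mult field_simps)
      qed
      then show ?thesis using P(1,2) by blast
    qed
  qed
qed

end

theorem theorem1p2:
  fixes X :: "'a topology" and L :: "'v::real_vector topology" and i :: "'a \<Rightarrow> 'v"
  assumes "tychonoff_space X"
    and "free_locally_convex_space X L i"
  shows "ascoli_space L \<longleftrightarrow> countable_discrete_space X"
proof -
  interpret free_lcs L X i
    using assms(2) by unfold_locales (simp_all add: free_locally_convex_space_def)
  show ?thesis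
  proof
    assume L: "ascoli_space L"
    have "\<forall>x\<in>topspace X. openin X {x}"
      using ascoli_imp_openin_singleton[OF assms(1) L] by blast
    then have X: "X = discrete_topology (topspace X)"
      using discrete_topology_unique[of "topspace X" X] by simp
    then show "countable_discrete_space X"
      unfolding countable_discrete_space_def
      using ascoli_discrete_imp_countable[OF X L] by blast
  next
    assume "countable_discrete_space X"
    then show "ascoli_space L"
      unfolding countable_discrete_space_def using countable_discrete_imp_ascoli by blast
  qed
qed

end
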